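(* Let $\ell\ge 1$ be an integer, $\tau\in\mathbb C$ with $\mathrm{Im}\,\tau>0$, and let $\eta\in\mathbb C$ be generic (i.e. $m\eta\notin\mathbb Z+\tau\mathbb Z$ for every nonzero integer $m$). Let $E\in\mathbb C$, $K\in\mathbb C\setminus\{0\}$ (with a fixed choice of $\log K$ used to define $K^{x/\eta}$), and $\zeta\in\mathbb C\setminus(\mathbb Z+\tau\mathbb Z)$. Then the difference Lamé equation $$\psi(x+\eta)+\frac{\theta_1(x+\ell\eta)\,\theta_1(x-(\ell+1)\eta)}{\theta_1(x)\,\theta_1(x-\eta)}\,\psi(x-\eta)=E\,\psi(x)$$ has a nontrivial double-Bloch solution of the form $$\psi(x)=K^{x/\eta}\sum_{j=1}^{\ell}s_j\,\Phi(x-j\eta,\zeta),\qquad (s_1,\dots,s_\ell)\in\mathbb C^\ell\setminus\{0\}\ \text{ independent of } x,$$ if and only if $(\zeta,K,E)$ satisfies the two equations $$\sum_{j=0}^{\ell}(-1)^jK^{-j}\,\theta_1(\zeta-j\eta)\begin{bmatrix}\ell\\ j\end{bmatrix}A^{(\ell)}_j(E)=0,$$ $$\sum_{j=0}^{\ell+1}(-1)^jK^{-j}\,\theta_1(\zeta-j\eta)\,[j-1]\begin{bmatrix}\ell+1\\ j\end{bmatrix}A^{(\ell)}_{|j-1|}(E)=0,$$ where $A^{(\ell)}_j(E)$ is the polynomial of degree $\ell-j$ in $E$ given, for $0\le s\le \ell$, by $$A^{(\ell)}_{\ell-s}(E)=\begin{bmatrix}\ell\\ s\end{bmatrix}\begin{bmatrix}2\ell\\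 s\end{bmatrix}^{-1}\det\left(E\,\delta_{i,j}+\frac{[-i]}{[\ell+1-i]}\,\delta_{i,j-1}+\frac{[2\ell+2-i]}{[\ell+1-i]}\,\delta_{i,j+1}\right)_{1\le i,j\le s},$$ with $A^{(\ell)}_\ell=1$.
   Context: $\theta_1(x)=\theta_1(x|\tau)=-\sum_{k\in\mathbb Z}\exp\big(\pi i\tau(k+\tfrac12)^2+2\pi i(x+\tfrac12)(k+\tfrac12)\big)$ is the odd Jacobi theta function, with simple zeros exactly at $\mathbb Z+\tau\mathbb Z$. Elliptic numbers: $[j]=\theta_1(j\eta)/\theta_1(\eta)$ for $j\in\mathbb Z$ (so $[-j]=-[j]$, $[0]=0$), $[n]!=\prod_{j=1}^n[j]$ (with $[0]!=1$), and $\begin{bmatrix}n\\ m\end{bmatrix}=\dfrac{[n]!}{[m]!\,[n-m]!}$. $\Phi(x,\zeta)=\dfrac{\theta_1(\zeta+x)}{\theta_1(x)\theta_1(\zeta)}$; it satisfies $\Phi(x+1,\zeta)=\Phi(x,\zeta)$ and $\Phi(x+\tau,\zeta)=e^{-2\pi i\zeta}\Phi(x,\zeta)$. A function $\psi$ is double-Bloch if $\psi(x+1)=B_1\psi(x)$ and $\psi(x+\tau)=B_\tau\psi(x)$ for some constants $B_1,B_\tau$; for the ansatz above $B_1=K^{1/\eta}$, $B_\tau=K^{\tau/\eta}e^{-2\pi i\zeta}$. *)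

theory Defs
  imports
    "HOL-Analysis.Infinite_Sum"
    "Jordan_Normal_Form.Determinant"
begin

definition theta1 :: "complex \<Rightarrow> complex \<Rightarrow> complex" where
  "theta1 \<tau> x =
     - (\<Sum>\<^sub>\<infinity>k::int. exp (of_real pi * \<i> * \<tau> * (of_int k + 1/2)^2
                        + 2 * of_real pi * \<i> * (x + 1/2) * (of_int k + 1/2)))"

definition period_lattice :: "complex \<Rightarrow> complex set" where
  "period_lattice \<tau> = {of_int a + of_int b * \<tau> | a b :: int. True}"

definition ell_num :: "complex \<Rightarrow> complex \<Rightarrow> int \<Rightarrow> complex" where
  "ell_num \<tau> \<eta> j = theta1 \<tau> (of_int j * \<eta>) / theta1 \<tau> \<eta>"

definition ell_fact :: "complex \<Rightarrow> complex \<Rightarrow> nat \<Rightarrow> complex" where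
  "ell_fact \<tau> \<eta> n = (\<Prod>j=1..n. ell_num \<tau> \<eta> (int j))"

text \<open>The elliptic binomial coefficient is only meaningful for \<open>m \<le> n\<close>.\<close>

definition ell_binom :: "complex \<Rightarrow> complex \<Rightarrow> nat \<Rightarrow> nat \<Rightarrow> complex" where
  "ell_binom \<tau> \<eta> n m = ell_fact \<tau> \<eta> n / (ell_fact \<tau> \<eta> m * ell_fact \<tau> \<eta> (n - m))"

definition Phi :: "complex \<Rightarrow> complex \<Rightarrow> complex \<Rightarrow> complex" where
  "Phi \<tau> x \<zeta> = theta1 \<tau> (\<zeta> + x) / (theta1 \<tau> x * theta1 \<tau> \<zeta>)"

text \<open>
  Meromorphic functions are represented by total functions. For the functions considered
  here the poles are simple poles of quotients of theta functions, where division by zero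
  returns \<open>0\<close>; this is compatible with the quasi-periods, so the relations below may be
  required at every point.
\<close>

definition double_bloch :: "complex \<Rightarrow> (complex \<Rightarrow> complex) \<Rightarrow> bool" where
  "double_bloch \<tau> \<psi> \<longleftrightarrow>
     (\<exists>B\<^sub>1 B\<^sub>\<tau>. \<forall>x. \<psi> (x + 1) = B\<^sub>1 * \<psi> x \<and> \<psi> (x + \<tau>) = B\<^sub>\<tau> * \<psi> x)"

text \<open>
  The ansatz; \<open>L\<close> is the chosen logarithm of \<open>K\<close>, so that \<open>exp (x / \<eta> * L)\<close>
  is \<open>K\<close> to the power \<open>x / \<eta>\<close>.
\<close>

definition bloch_ansatz ::
  "complex \<Rightarrow> complex \<Rightarrow> nat \<Rightarrow> complex \<Rightarrow> complex \<Rightarrow> (nat \<Rightarrow> complex) \<Rightarrow> complex \<Rightarrow> complex" where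
  "bloch_ansatz \<tau> \<eta> l L \<zeta> s x =
     exp (x / \<eta> * L) * (\<Sum>j=1..l. s j * Phi \<tau> (x - of_nat j * \<eta>) \<zeta>)"

text \<open>
  The points at which the coefficient of the difference Lame equation and the three shifted
  values \<open>\<psi> (x + \<eta>)\<close>, \<open>\<psi> (x - \<eta>)\<close>, \<open>\<psi> x\<close> of the ansatz are all free of poles.
  An identity between meromorphic functions with these poles is an identity on this set.
\<close>

definition lame_domain :: "complex \<Rightarrow> complex \<Rightarrow> nat \<Rightarrow> complex set" where
  "lame_domain \<tau> \<eta> l = {x. \<forall>j\<in>{0..l+1}. x - of_nat j * \<eta> \<notin> period_lattice \<tau>}"

definition lame_equation ::
  "complex \<Rightarrow> complex \<Rightarrow> nat \<Rightarrow> complex \<Rightarrow> (complex \<Rightarrow> complex) \<Rightarrow> complex \<Rightarrow> bool" where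
  "lame_equation \<tau> \<eta> l E \<psi> x \<longleftrightarrow>
     \<psi> (x + \<eta>)
       + theta1 \<tau> (x + of_nat l * \<eta>) * theta1 \<tau> (x - of_nat (l + 1) * \<eta>)
           / (theta1 \<tau> x * theta1 \<tau> (x - \<eta>)) * \<psi> (x - \<eta>)
     = E * \<psi> x"

text \<open>
  The \<open>s \<times> s\<close> tridiagonal matrix over the polynomial ring in the indeterminate \<open>E\<close>.
  Matrix indices start at \<open>0\<close>, whence the shift to \<open>i, j \<in> {1..s}\<close>.
\<close>

definition lame_matrix :: "complex \<Rightarrow> complex \<Rightarrow> nat \<Rightarrow> nat \<Rightarrow> complex poly mat" where
  "lame_matrix \<tau> \<eta> l s = mat s s (\<lambda>(i\<^sub>0, j\<^sub>0).
     let i = int i\<^sub>0 + 1; j = int j\<^sub>0 + 1 in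
       (if i = j then [:0, 1:] else 0)
     + (if i = j - 1
        then [:ell_num \<tau> \<eta> (- i) / ell_num \<tau> \<eta> (int l + 1 - i):] else 0)
     + (if i = j + 1
        then [:ell_num \<tau> \<eta> (2 * int l + 2 - i) / ell_num \<tau> \<eta> (int l + 1 - i):] else 0))"

text \<open>The polynomial \<open>A\<^sub>j\<close> for \<open>0 \<le> j \<le> l\<close>; here \<open>s = l - j\<close>.\<close>

definition lame_poly :: "complex \<Rightarrow> complex \<Rightarrow> nat \<Rightarrow> nat \<Rightarrow> complex poly" where
  "lame_poly \<tau> \<eta> l j = (let s = l - j in
     smult (ell_binom \<tau> \<eta> l s * inverse (ell_binom \<tau> \<eta> (2 * l) s)) (det (lame_matrix \<tau> \<eta> l s)))"

end

theory Submission
  imports "HOL-Complex_Analysis.Complex_Analysis" Defs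
begin

text \<open>
  After division by \<open>K\<close> to the power \<open>x / \<eta>\<close>, the two sides of the Lame equation for the ansatz
  have the same multipliers \<open>1\<close> and \<open>exp (- 2 \<pi> i \<zeta>)\<close>. Since \<open>\<zeta>\<close> is not a period, an entire function with
  these multipliers vanishes, so a partial fraction expansion writes the difference of the two sides as
  \<open>\<Sum>m\<le>l. r\<^sub>m \<Phi>(x - m \<eta>, \<zeta>)\<close>, and the equation holds iff all \<open>r\<^sub>m\<close> vanish. The conditions for
  \<open>m = 2, \<dots>, l\<close> are a three-term recurrence, which the tridiagonal determinants solve: up to scaling,
  \<open>s\<^sub>m\<close> is \<open>(-1)^m K^(-m) [m] [l; m] A\<^sub>m\<close>, where \<open>[l; m]\<close> is the elliptic binomial coefficient. For
  these coefficients \<open>r\<^sub>1 = 0\<close> and \<open>r\<^sub>0 = 0\<close> are the first and the second equation.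

  The zeros of \<open>theta1\<close> are located by dividing it by the triple product: the quotient is
  entire and doubly periodic, hence constant.
\<close>

text \<open>The coefficient of the equation has zeros -l\<eta>, (l+1)\<eta> and poles 0, \<eta>. The
  two pairs have the same sum, so the coefficient is elliptic and multiplying \<open>Phi\<close> by
  it keeps the multipliers. The shift by \<eta> would create a pole of \<psi>(x-\<eta>) at
  (l+1)\<eta>, but the coefficient vanishes there; hence only the residues 0, ..., l occur. These
  are l+1 linear conditions on l unknowns: l-1 of them fix the coefficients up to a scalar, and the
  last two restrict (\<zeta>, K, E).

  The recurrence is read downwards from s_l. Upwards it would leave two free initial values and a
  closing condition. Downwards it divides by [m+l][m-l-1]/([m][m-1]), which is nonzero for 2 \<le> m
  \<le> l because \<eta> is generic, and it starts from a multiple of A_l = 1. So no value of E is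
  exceptional, even if some A_j(E) vanish.

  Since \<open>theta1\<close> is given only as a series, its quasi-periods and oddness are matters
  of reindexing, whereas the location and simplicity of its zeros need a separate argument.
  Everything after that divides by theta factors and relies on these zeros.\<close>

lemma entire_imp_isCont:
  fixes f :: "complex \<Rightarrow> complex"
  assumes "f holomorphic_on UNIV"
  shows "isCont f z"
  using assms by (meson UNIV_I continuous_on_eq_continuous_at holomorphic_on_imp_continuous_on open_UNIV)

lemma entire_compose:
  fixes f g :: "complex \<Rightarrow> complex"
  assumes "f holomorphic_on UNIV" "g holomorphic_on UNIV"
  shows "(\<lambda>x. f (g x)) holomorphic_on UNIV"
  using holomorphic_on_compose[OF assms(2) holomorphic_on_subset[OF assms(1)]] by (simp add: o_def)

section \<open>The theta series\<close>

text \<open>Ratio test for the two q-series below, whose coefficients satisfy first-order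
  recurrences. Absolute summability is recorded because \<open>has_sum\<close> over the integers
  requires it.\<close>

lemma summable_power_series_of_ratio_tendsto_0:
  fixes c r :: "nat \<Rightarrow> complex"
  assumes "\<And>n. c (Suc n) = r n * c n" "r \<longlonglongrightarrow> 0"
  shows "summable (\<lambda>n. norm (c n * w ^ n))"
proof -
  have "(\<lambda>n. norm (r n * w)) \<longlonglongrightarrow> norm (0 * w)"
    by (intro tendsto_intros assms)
  then have "eventually (\<lambda>n. norm (r n * w) < 1/2) sequentially"
    by (intro order_tendstoD(2)[where y = "norm (0 * w)"]) auto
  then obtain N where N: "\<And>n. n \<ge> N \<Longrightarrow> norm (r n * w) < 1/2"
    by (auto simp: eventually_sequentially)
  show ?thesis
  proof (rule summable_ratio_test[where c = "1/2" and N = N])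
    fix n assume "n \<ge> N"
    have "norm (c (Suc n) * w ^ Suc n) = norm (r n * w) * norm (c n * w ^ n)"
      by (simp add: assms norm_mult norm_power mult_ac)
    also have "\<dots> \<le> 1/2 * norm (c n * w ^ n)"
      using N[OF \<open>n \<ge> N\<close>] by (intro mult_right_mono) auto
    finally show "norm (norm (c (Suc n) * w ^ Suc n)) \<le> 1/2 * norm (norm (c n * w ^ n))"
      by simp
  qed auto
qed

lemma power_series_entire:
  fixes c :: "nat \<Rightarrow> complex"
  assumes "\<And>w. summable (\<lambda>n. c n * w ^ n)"
  shows "(\<lambda>w. \<Sum>n. c n * w ^ n) holomorphic_on UNIV"
  using termdiffs_strong_converges_everywhere[OF assms]
  unfolding holomorphic_on_def field_differentiable_def
  by (blast intro: has_field_derivative_at_within)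

lemma exp_2pi_i_tau_norm_less_1:
  assumes "Im \<tau> > 0"
  shows "norm (exp (2 * of_real pi * \<i> * \<tau>)) < 1"
  using assms by (simp add: norm_exp_eq_Re)

text \<open>With q = exp(2\<pi>i\<tau>), the quotient of consecutive coefficients of the folded
  theta series is -q^(j+1).\<close>

lemma theta1_coeff_ratio_tendsto_0:
  assumes "Im \<tau> > 0"
  shows "(\<lambda>j. - (exp (2 * of_real pi * \<i> * \<tau>) ^ Suc j)) \<longlonglongrightarrow> 0"
proof -
  have "(\<lambda>j. exp (2 * of_real pi * \<i> * \<tau>) ^ Suc j) \<longlonglongrightarrow> 0"
    using LIMSEQ_power_zero[OF exp_2pi_i_tau_norm_less_1[OF assms]] by (rule LIMSEQ_Suc)
  then show ?thesis using tendsto_minus by fastforce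
qed

lemma exp_pi_i_odd: "exp (of_real pi * \<i> * (2 * of_int k + 1)) = -1"
proof -
  have "exp (of_real pi * \<i> * (2 * of_int k + 1)) = exp (\<i> * (of_int k * (of_real pi * 2))) * exp (\<i> * of_real pi)"
    by (simp add: exp_add[symmetric] algebra_simps)
  then show ?thesis by simp
qed

lemma theta1_add_1: "theta1 \<tau> (x + 1) = - theta1 \<tau> x"
proof -
  have "exp (of_real pi * \<i> * \<tau> * (of_int k + 1/2)^2 + 2 * of_real pi * \<i> * (x + 1 + 1/2) * (of_int k + 1/2))
     = - exp (of_real pi * \<i> * \<tau> * (of_int k + 1/2)^2 + 2 * of_real pi * \<i> * (x + 1/2) * (of_int k + 1/2))"
    for k :: int
  proof -
    have "exp (of_real pi * \<i> * \<tau> * (of_int k + 1/2)^2 + 2 * of_real pi * \<i> * (x + 1 + 1/2) * (of_int k + 1/2))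
      = exp (of_real pi * \<i> * \<tau> * (of_int k + 1/2)^2 + 2 * of_real pi * \<i> * (x + 1/2) * (of_int k + 1/2))
        * exp (of_real pi * \<i> * (2 * of_int k + 1))"
      unfolding exp_add[symmetric] by (simp add: algebra_simps)
    then show ?thesis by (simp only: exp_pi_i_odd mult_minus_left mult_minus_right mult_1_left mult_1_right)
  qed
  then show ?thesis
    unfolding theta1_def by (simp add: infsum_uminus)
qed

text \<open>Completing the square, \<tau>(k+1/2)^2 + 2\<tau>(k+1/2) = \<tau>(k+3/2)^2 - \<tau>:
  moving x by \<tau> amounts to moving k by 1, up to a factor independent of k.\<close>

lemma theta1_add_tau:
  "theta1 \<tau> (x + \<tau>) = - exp (- of_real pi * \<i> * \<tau> - 2 * of_real pi * \<i> * x) * theta1 \<tau> x"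
proof -
  let ?t = "\<lambda>k::int. exp (of_real pi * \<i> * \<tau> * (of_int k + 1/2)^2 + 2 * of_real pi * \<i> * (x + 1/2) * (of_int k + 1/2))"
  have step: "exp (of_real pi * \<i> * \<tau> * (of_int k + 1/2)^2 + 2 * of_real pi * \<i> * (x + \<tau> + 1/2) * (of_int k + 1/2))
     = - exp (- of_real pi * \<i> * \<tau> - 2 * of_real pi * \<i> * x) * ?t (k + 1)" for k :: int
  proof -
    have "exp (of_real pi * \<i> * \<tau> * (of_int k + 1/2)^2 + 2 * of_real pi * \<i> * (x + \<tau> + 1/2) * (of_int k + 1/2))
      = exp (of_real pi * \<i> * (2 * of_int (-1) + 1)) * exp (- of_real pi * \<i> * \<tau> - 2 * of_real pi * \<i> * x) * ?t (k + 1)"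
      unfolding exp_add[symmetric]
      by (intro arg_cong[of _ _ exp]) (simp add: power2_eq_square field_simps)
    then show ?thesis by (simp only: exp_pi_i_odd mult_minus_left mult_minus_right mult_1_left mult_1_right)
  qed
  have "infsum (\<lambda>k. ?t (k + 1)) UNIV = infsum ?t UNIV"
    by (rule infsum_reindex_bij_betw) (rule bij_plus_right)
  then show ?thesis
    unfolding theta1_def step by (simp add: infsum_cmult_right' infsum_uminus)
qed

text \<open>The reflection k -> -1-k negates k+1/2, and the half shift in x contributes the sign
  exp(\<pi>i(2k+1)) = -1.\<close>

lemma theta1_minus: "theta1 \<tau> (- x) = - theta1 \<tau> x"
proof -
  let ?t = "\<lambda>k::int. exp (of_real pi * \<i> * \<tau> * (of_int k + 1/2)^2 + 2 * of_real pi * \<i> * (x + 1/2) * (of_int k + 1/2))"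
  have step: "exp (of_real pi * \<i> * \<tau> * (of_int k + 1/2)^2 + 2 * of_real pi * \<i> * (- x + 1/2) * (of_int k + 1/2))
     = - ?t (- 1 - k)" for k :: int
  proof -
    have "exp (of_real pi * \<i> * \<tau> * (of_int k + 1/2)^2 + 2 * of_real pi * \<i> * (- x + 1/2) * (of_int k + 1/2))
      = exp (of_real pi * \<i> * (2 * of_int k + 1)) * ?t (- 1 - k)"
      unfolding exp_add[symmetric]
      by (intro arg_cong[of _ _ exp]) (simp add: power2_eq_square field_simps)
    then show ?thesis by (simp only: exp_pi_i_odd mult_minus_left mult_minus_right mult_1_left mult_1_right)
  qed
  have "bij (\<lambda>k::int. - 1 - k)"
    by (rule involuntory_imp_bij) simp
  then have "infsum (\<lambda>k. ?t (- 1 - k)) UNIV = infsum ?t UNIV"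
    by (rule infsum_reindex_bij_betw)
  then show ?thesis
    unfolding theta1_def step by (simp add: infsum_uminus)
qed

lemma theta1_0: "theta1 \<tau> 0 = 0"
  using theta1_minus[of \<tau> 0] by (simp add: eq_neg_iff_add_eq_0)

text \<open>Folding \<open>k\<close> with \<open>- 1 - k\<close> expresses \<open>theta1\<close> by one entire power series in
  \<open>exp (2 \<pi> i x)\<close> and its value at the reciprocal.\<close>

lemma theta1_power_series:
  assumes "Im \<tau> > 0"
  obtains G where "G holomorphic_on UNIV" "G 0 \<noteq> 0"
    "\<And>x. theta1 \<tau> x = exp (- of_real pi * \<i> * x) * G (exp (- 2 * of_real pi * \<i> * x))
          - exp (of_real pi * \<i> * x) * G (exp (2 * of_real pi * \<i> * x))"
proof -
  \<comment> \<open>The term with index k = j \<ge> 0, freed of its dependence on x, which is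
    exp(\<pi>ix) exp(2\<pi>ix)^j.\<close>
  define b where "b j = exp (of_real pi * \<i> * \<tau> * (of_nat j + 1/2)^2 + of_real pi * \<i> * (of_nat j + 1/2))" for j :: nat
  define G where "G w = (\<Sum>j. b j * w ^ j)" for w
  have b_Suc: "b (Suc j) = - (exp (2 * of_real pi * \<i> * \<tau>) ^ Suc j) * b j" for j
  proof -
    have "b (Suc j) = exp (\<i> * of_real pi) * exp (of_nat (Suc j) * (2 * of_real pi * \<i> * \<tau>)) * b j"
      unfolding b_def exp_add[symmetric]
      by (intro arg_cong[of _ _ exp]) (simp add: power2_eq_square field_simps)
    then show ?thesis by (simp only: exp_of_nat_mult exp_pi_i') simp
  qed
  have sm: "summable (\<lambda>j. norm (b j * w ^ j))" for w
    by (rule summable_power_series_of_ratio_tendsto_0[OF b_Suc theta1_coeff_ratio_tendsto_0[OF assms]])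
  have hs: "((\<lambda>j. b j * w ^ j) has_sum G w) UNIV" for w
    unfolding G_def using sm
    by (intro norm_summable_imp_has_sum sm summable_sums) (rule summable_norm_cancel)
  have "theta1 \<tau> x = exp (- of_real pi * \<i> * x) * G (exp (- 2 * of_real pi * \<i> * x))
          - exp (of_real pi * \<i> * x) * G (exp (2 * of_real pi * \<i> * x))" for x
  proof -
    let ?t = "\<lambda>k::int. exp (of_real pi * \<i> * \<tau> * (of_int k + 1/2)^2 + 2 * of_real pi * \<i> * (x + 1/2) * (of_int k + 1/2))"
    let ?W = "exp (2 * of_real pi * \<i> * x)" and ?V = "exp (- 2 * of_real pi * \<i> * x)"
    have pos: "?t (int j) = exp (of_real pi * \<i> * x) * (b j * ?W ^ j)" for j
      unfolding b_def exp_of_nat_mult[symmetric] exp_add[symmetric]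
      by (intro arg_cong[of _ _ exp]) (simp add: field_simps)
    have neg: "?t (- 1 - int j) = - exp (- of_real pi * \<i> * x) * (b j * ?V ^ j)" for j
    proof -
      have "?t (- 1 - int j) = exp (of_real pi * \<i> * (2 * of_int (- 1 - int j) + 1)) * exp (- of_real pi * \<i> * x) * (b j * ?V ^ j)"
        unfolding b_def exp_of_nat_mult[symmetric] exp_add[symmetric]
        by (intro arg_cong[of _ _ exp]) (simp add: power2_eq_square field_simps)
      then show ?thesis by (simp only: exp_pi_i_odd mult_minus_left mult_minus_right mult_1_left mult_1_right)
    qed
    have "((\<lambda>j. ?t (int j)) has_sum exp (of_real pi * \<i> * x) * G ?W) UNIV"
      unfolding pos by (intro has_sum_cmult_right hs)
    then have 1: "(?t has_sum exp (of_real pi * \<i> * x) * G ?W) (range int)"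
      by (subst has_sum_reindex) (auto simp: o_def)
    have "((\<lambda>j. ?t (- 1 - int j)) has_sum - exp (- of_real pi * \<i> * x) * G ?V) UNIV"
      unfolding neg by (intro has_sum_cmult_right hs)
    then have 2: "(?t has_sum - exp (- of_real pi * \<i> * x) * G ?V) (range (\<lambda>j. - 1 - int j))"
      by (subst has_sum_reindex) (auto simp: o_def inj_def)
    have "k \<in> range int \<union> range (\<lambda>j. - 1 - int j)" for k
      by (cases "k \<ge> 0") (auto simp: image_iff intro: exI[of _ "nat k"] exI[of _ "nat (- 1 - k)"])
    then have U: "range int \<union> range (\<lambda>j. - 1 - int j) = UNIV" by blast
    have "range int \<inter> range (\<lambda>j. - 1 - int j) = {}" by auto
    then have "(?t has_sum exp (of_real pi * \<i> * x) * G ?W + - exp (- of_real pi * \<i> * x) * G ?V) UNIV"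
      using has_sum_Un_disjoint[OF 1 2] unfolding U by blast
    from infsumI[OF this] show ?thesis
      unfolding theta1_def by simp
  qed
  moreover have "G holomorphic_on UNIV"
    unfolding G_def by (rule power_series_entire[OF summable_norm_cancel[OF sm]])
  moreover have "G 0 \<noteq> 0"
    by (simp add: G_def b_def)
  ultimately show thesis using that by blast
qed

lemma theta1_holomorphic:
  assumes "Im \<tau> > 0"
  shows "theta1 \<tau> holomorphic_on UNIV"
proof -
  obtain G where G: "G holomorphic_on UNIV"
    "\<And>x. theta1 \<tau> x = exp (- of_real pi * \<i> * x) * G (exp (- 2 * of_real pi * \<i> * x))
          - exp (of_real pi * \<i> * x) * G (exp (2 * of_real pi * \<i> * x))"
    using theta1_power_series[OF assms] by blast
  show ?thesis
    unfolding G(2) by (intro holomorphic_intros entire_compose[OF G(1)])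
qed

text \<open>If \<open>theta1\<close> vanished identically, the power series would satisfy G(v) =
  G(1/v)/v. Then G tends to 0 at infinity, so G = 0 by Liouville, against G(0) \<noteq> 0.\<close>

lemma theta1_not_identically_0:
  assumes "Im \<tau> > 0"
  obtains x where "theta1 \<tau> x \<noteq> 0"
proof -
  obtain G where G: "G holomorphic_on UNIV" "G 0 \<noteq> 0"
    "\<And>x. theta1 \<tau> x = exp (- of_real pi * \<i> * x) * G (exp (- 2 * of_real pi * \<i> * x))
          - exp (of_real pi * \<i> * x) * G (exp (2 * of_real pi * \<i> * x))"
    using theta1_power_series[OF assms] by blast
  have "\<exists>x. theta1 \<tau> x \<noteq> 0"
  proof (rule ccontr)
    assume zero: "\<not> ?thesis"
    have refl: "G v = inverse v * G (inverse v)" if "v \<noteq> 0" for v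
    proof -
      define x where "x = - Ln v / (2 * of_real pi * \<i>)"
      have e: "exp (- 2 * of_real pi * \<i> * x) = v" "exp (2 * of_real pi * \<i> * x) = inverse v"
        using that by (simp_all add: x_def exp_minus)
      have "exp (- of_real pi * \<i> * x) * G v = exp (of_real pi * \<i> * x) * G (inverse v)"
        using zero G(3)[of x] unfolding e by auto
      then have "exp (of_real pi * \<i> * x) * (exp (- of_real pi * \<i> * x) * G v)
          = exp (of_real pi * \<i> * x) * (exp (of_real pi * \<i> * x) * G (inverse v))"
        by simp
      then have "G v = exp (of_real pi * \<i> * x + of_real pi * \<i> * x) * G (inverse v)"
        unfolding mult.assoc[symmetric] exp_add[symmetric] by simp
      also have "of_real pi * \<i> * x + of_real pi * \<i> * x = 2 * of_real pi * \<i> * x" by simp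
      finally show ?thesis unfolding e .
    qed
    have "((\<lambda>v. inverse v * G (inverse v)) \<longlongrightarrow> 0 * G 0) at_infinity"
    proof (intro tendsto_mult tendsto_inverse_0)
      have "isCont G 0"
        by (rule entire_imp_isCont[OF G(1)])
      then show "((\<lambda>v. G (inverse v)) \<longlongrightarrow> G 0) at_infinity"
        by (rule isCont_tendsto_compose) (rule tendsto_inverse_0)
    qed
    moreover have "eventually (\<lambda>v. inverse v * G (inverse v) = G v) at_infinity"
      unfolding eventually_at_infinity by (intro exI[of _ 1] allI impI refl[symmetric]) auto
    ultimately have "(G \<longlongrightarrow> 0) at_infinity"
      by (simp add: tendsto_cong)
    then show False using Liouville_weak_0[OF G(1)] G(2) by blast
  qed
  then show thesis using that by blast
qed

section \<open>The q-Pochhammer function and its zeros\<close>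

lemma power_Suc_neq_1_of_norm_less_1:
  fixes Q :: complex
  assumes "norm Q < 1"
  shows "Q ^ Suc n \<noteq> 1"
proof
  assume "Q ^ Suc n = 1"
  then have "norm Q ^ Suc n = 1" by (metis norm_one norm_power)
  moreover have "norm Q ^ Suc n \<le> norm Q"
    using assms by (simp add: mult_left_le power_le_one)
  ultimately show False using assms by simp
qed

text \<open>This is the product of all 1 - Q^n w, n \<ge> 0, obtained from Euler's power series
  instead of an infinite product, so that it is entire at once. Its functional equation is all that
  is used later.\<close>

lemma euler_function_exists:
  fixes Q :: complex
  assumes "norm Q < 1"
  obtains \<phi> where "\<phi> holomorphic_on UNIV" "\<phi> 0 = 1" "\<And>w. \<phi> w = (1 - w) * \<phi> (Q * w)"
proof -
  \<comment> \<open>Comparing coefficients of w^(n+1) in the functional equation gives c_(n+1) (1 -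
    Q^(n+1)) = -Q^n c_n.\<close>
  define r where "r n = - (Q ^ n) / (1 - Q ^ Suc n)" for n
  define c where "c n = (\<Prod>i<n. r i)" for n
  have c_Suc: "c (Suc n) = r n * c n" for n by (simp add: c_def)
  have "Q ^ Suc n \<noteq> 1" for n
    by (rule power_Suc_neq_1_of_norm_less_1[OF assms])
  then have c_rec: "c (Suc n) * (1 - Q ^ Suc n) = - (Q ^ n) * c n" for n
    by (simp add: c_Suc r_def)
  have "r \<longlonglongrightarrow> - 0 / (1 - 0)"
    unfolding r_def using assms
    by (intro tendsto_intros LIMSEQ_power_zero LIMSEQ_Suc[OF LIMSEQ_power_zero]) auto
  then have sm': "summable (\<lambda>n. norm (c n * w ^ n))" for w
    using summable_power_series_of_ratio_tendsto_0[of c r, OF c_Suc] by simp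
  then have sm: "summable (\<lambda>n. c n * w ^ n)" for w by (rule summable_norm_cancel)
  define \<phi> where "\<phi> w = (\<Sum>n. c n * w ^ n)" for w
  have "\<phi> w = (1 - w) * \<phi> (Q * w)" for w
  proof -
    have "\<phi> w - \<phi> (Q * w) = (\<Sum>n. c n * w ^ n - c n * (Q * w) ^ n)"
      unfolding \<phi>_def by (intro suminf_diff sm)
    also have "\<dots> = (\<Sum>n. c (Suc n) * w ^ Suc n - c (Suc n) * (Q * w) ^ Suc n)"
      by (subst suminf_split_head) (auto intro!: summable_diff sm)
    also have "(\<lambda>n. c (Suc n) * w ^ Suc n - c (Suc n) * (Q * w) ^ Suc n) = (\<lambda>n. - w * (c n * (Q * w) ^ n))"
    proof
      fix n
      have "c (Suc n) * w ^ Suc n - c (Suc n) * (Q * w) ^ Suc n = (c (Suc n) * (1 - Q ^ Suc n)) * w ^ Suc n"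
        by (simp add: algebra_simps power_mult_distrib)
      also have "\<dots> = - w * (c n * (Q * w) ^ n)"
        unfolding c_rec by (simp add: algebra_simps power_mult_distrib)
      finally show "c (Suc n) * w ^ Suc n - c (Suc n) * (Q * w) ^ Suc n = - w * (c n * (Q * w) ^ n)" .
    qed
    also have "suminf \<dots> = - w * \<phi> (Q * w)"
      unfolding \<phi>_def by (intro suminf_mult sm)
    finally show ?thesis by (simp add: algebra_simps)
  qed
  moreover have "\<phi> holomorphic_on UNIV"
    unfolding \<phi>_def by (intro power_series_entire sm)
  moreover have "\<phi> 0 = 1"
    by (simp add: \<phi>_def c_def)
  ultimately show thesis using that by blast
qed

text \<open>As long as no factor 1 - Q^n w vanishes, a zero at w is passed on to all points Q^n w.
  These tend to 0, where the value is 1. Conversely the functional equation carries the zero at 1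
  back to w.\<close>

lemma euler_function_zero_iff:
  fixes Q :: complex
  assumes "norm Q < 1" "\<phi> holomorphic_on UNIV" "\<phi> 0 = 1" and fe: "\<And>w. \<phi> w = (1 - w) * \<phi> (Q * w)"
  shows "\<phi> w = 0 \<longleftrightarrow> (\<exists>n. Q ^ n * w = 1)"
proof
  assume z: "\<phi> w = 0"
  show "\<exists>n. Q ^ n * w = 1"
  proof (rule ccontr)
    assume ne: "\<nexists>n. Q ^ n * w = 1"
    have "\<phi> (Q ^ n * w) = 0" for n
    proof (induction n)
      case (Suc n)
      then show ?case using fe[of "Q ^ n * w"] ne by (auto simp: mult.assoc)
    qed (use z in simp)
    moreover have "(\<lambda>n. \<phi> (Q ^ n * w)) \<longlonglongrightarrow> \<phi> (0 * w)"
    proof -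
      have "isCont \<phi> (0 * w)"
        by (rule entire_imp_isCont[OF assms(2)])
      moreover have "(\<lambda>n. Q ^ n * w) \<longlonglongrightarrow> 0 * w"
        by (intro tendsto_intros LIMSEQ_power_zero assms)
      ultimately show ?thesis by (rule isCont_tendsto_compose)
    qed
    ultimately show False using assms(3) by (simp add: LIMSEQ_const_iff)
  qed
next
  assume "\<exists>n. Q ^ n * w = 1"
  then obtain n where "Q ^ n * w = 1" by blast
  then show "\<phi> w = 0"
  proof (induction n arbitrary: w)
    case 0
    then show ?case by (subst fe) simp
  next
    case (Suc n)
    then have "\<phi> (Q * w) = 0" by (simp add: mult_ac)
    then show ?case by (subst fe) simp
  qed
qed

section \<open>Entire quasi-periodic functions\<close>

text \<open>Near a zero z of p, the quotient f/p equals the quotient of the difference quotients of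
  f and p at z, whose denominator tends to p'(z) \<noteq> 0. So the singularity is removable, with
  value f'(z)/p'(z).\<close>

lemma entire_divide:
  fixes f p :: "complex \<Rightarrow> complex"
  assumes f: "f holomorphic_on UNIV" and p: "p holomorphic_on UNIV"
    and zero: "\<And>z. p z = 0 \<Longrightarrow> f z = 0" and simple: "\<And>z. p z = 0 \<Longrightarrow> deriv p z \<noteq> 0"
  obtains g where "g holomorphic_on UNIV" "\<And>x. f x = p x * g x"
proof -
  define g where "g x = (if p x = 0 then deriv f x / deriv p x else f x / p x)" for x
  have "g field_differentiable at z" for z
  proof (cases "p z = 0")
    case False
    have "eventually (\<lambda>x. p x \<noteq> 0) (nhds z)"
      using entire_imp_isCont[OF p, of z] False
      by (simp add: continuous_at tendsto_imp_eventually_ne isCont_def eventually_nhds_conv_at)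
    then have "eventually (\<lambda>x. f x / p x = g x) (nhds z)"
      by eventually_elim (simp add: g_def)
    moreover have "(\<lambda>x. f x / p x) field_differentiable at z"
      using f p False by (intro field_differentiable_divide) (auto simp: holomorphic_on_def)
    ultimately show ?thesis
      unfolding field_differentiable_def by (metis DERIV_cong_ev)
  next
    case True
    define F where "F x = (if x = z then deriv f z else (f x - f z) / (x - z))" for x
    define H where "H x = (if x = z then deriv p z else (p x - p z) / (x - z))" for x
    have F: "F holomorphic_on UNIV" unfolding F_def by (rule pole_lemma_open[OF f open_UNIV])
    have H: "H holomorphic_on UNIV" unfolding H_def by (rule pole_lemma_open[OF p open_UNIV])
    have Hz: "H z \<noteq> 0" using simple[OF True] by (simp add: H_def)
    have "eventually (\<lambda>x. H x \<noteq> 0) (nhds z)"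
      using entire_imp_isCont[OF H, of z] Hz
      by (simp add: continuous_at tendsto_imp_eventually_ne isCont_def eventually_nhds_conv_at)
    then have "eventually (\<lambda>x. F x / H x = g x) (nhds z)"
      by eventually_elim (auto simp: g_def F_def H_def True zero)
    moreover have "(\<lambda>x. F x / H x) field_differentiable at z"
      using F H Hz by (intro field_differentiable_divide) (auto simp: holomorphic_on_def)
    ultimately show ?thesis
      unfolding field_differentiable_def by (metis DERIV_cong_ev)
  qed
  then have "g holomorphic_on UNIV" by (simp add: holomorphic_on_def)
  moreover have "f x = p x * g x" for x by (simp add: g_def zero)
  ultimately show thesis using that by blast
qed

lemma period_lattice_0: "0 \<in> period_lattice \<tau>"
  unfolding period_lattice_def by (auto intro!: exI[of _ 0])

lemma period_lattice_minus: "x \<in> period_lattice \<tau> \<Longrightarrow> - x \<in> period_lattice \<tau>"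
proof -
  assume "x \<in> period_lattice \<tau>"
  then obtain a b where "x = of_int a + of_int b * \<tau>" by (auto simp: period_lattice_def)
  then have "- x = of_int (- a) + of_int (- b) * \<tau>" by simp
  then show ?thesis unfolding period_lattice_def by blast
qed

lemma period_lattice_minus_iff: "- x \<in> period_lattice \<tau> \<longleftrightarrow> x \<in> period_lattice \<tau>"
  using period_lattice_minus[of x] period_lattice_minus[of "- x"] by auto

lemma period_lattice_coset_representative:
  fixes x \<tau> :: complex
  assumes "Im \<tau> > 0"
  obtains a b s t where "x = of_real s + of_real t * \<tau> + of_int a + of_int b * \<tau>"
    "s \<in> {0..1::real}" "t \<in> {0..1::real}"
proof -
  define v where "v = Im x / Im \<tau>"
  define u where "u = Re x - v * Re \<tau>"
  have x: "x = of_real u + of_real v * \<tau>"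
    using assms by (simp add: complex_eq_iff u_def v_def)
  have "of_real u = of_real (frac u) + (of_int \<lfloor>u\<rfloor> :: complex)"
       "of_real v = of_real (frac v) + (of_int \<lfloor>v\<rfloor> :: complex)"
    by (simp_all add: frac_def)
  then have "x = of_real (frac u) + of_real (frac v) * \<tau> + of_int \<lfloor>u\<rfloor> + of_int \<lfloor>v\<rfloor> * \<tau>"
    unfolding x by (simp add: algebra_simps)
  then show thesis
    using that[of "frac u" "frac v" "\<lfloor>u\<rfloor>" "\<lfloor>v\<rfloor>"] by (simp add: frac_ge_0 less_imp_le frac_lt_1)
qed

text \<open>The codomain is arbitrary so that F may be a norm or a truth value such as
  \<open>f z = 0\<close>; both are periodic when f is only quasi-periodic.\<close>

lemma invariant_add_of_int:
  fixes F :: "complex \<Rightarrow> 'a"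
  assumes "\<And>x. F (x + p) = F x"
  shows "F (x + of_int n * p) = F x"
proof (induction n rule: int_induct[where k = 0])
  case (step1 i)
  then show ?case using assms[of "x + of_int i * p"] by (simp add: algebra_simps)
next
  case (step2 i)
  then show ?case using assms[of "x + of_int (i - 1) * p"] by (simp add: algebra_simps)
qed simp

text \<open>Periodicity of the modulus suffices for boundedness, since every point is congruent to
  one in the compact parallelogram. This weaker form admits unimodular multipliers.\<close>

lemma entire_norm_doubly_periodic_imp_constant:
  fixes f :: "complex \<Rightarrow> complex"
  assumes "Im \<tau> > 0" and f: "f holomorphic_on UNIV"
    and "\<And>x. norm (f (x + 1)) = norm (f x)" "\<And>x. norm (f (x + \<tau>)) = norm (f x)"
  obtains c where "\<And>x. f x = c"
proof -
  define C where "C = (\<lambda>(s, t). of_real s + of_real t * \<tau>) ` ({0..1::real} \<times> {0..1::real})"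
  have "compact C"
    unfolding C_def case_prod_unfold
    by (intro compact_continuous_image continuous_intros compact_Times) auto
  then have "compact (f ` C)"
    using f by (meson compact_continuous_image holomorphic_on_imp_continuous_on holomorphic_on_subset subset_UNIV)
  then obtain B where B: "\<And>y. y \<in> f ` C \<Longrightarrow> norm y \<le> B"
    using compact_imp_bounded bounded_iff by metis
  have "norm (f x) \<le> B" for x
  proof -
    obtain a b s t where x: "x = of_real s + of_real t * \<tau> + of_int a + of_int b * \<tau>"
      and "s \<in> {0..1::real}" "t \<in> {0..1::real}"
      using period_lattice_coset_representative[OF assms(1)] by metis
    then have "of_real s + of_real t * \<tau> \<in> C" unfolding C_def by auto
    then have "norm (f (of_real s + of_real t * \<tau>)) \<le> B" using B by blast
    then show ?thesis
      unfolding x using invariant_add_of_int[of "\<lambda>x. norm (f x)", OF assms(3)]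
        invariant_add_of_int[of "\<lambda>x. norm (f x)", OF assms(4)] by (metis mult.right_neutral)
  qed
  then have "bounded (range f)" by (auto simp: bounded_iff)
  from Liouville_theorem[OF f this] show thesis using that by (auto simp: constant_on_def)
qed

text \<open>Multiplying by \<open>exp (i t x)\<close> with a suitable real \<open>t\<close> makes both multipliers unimodular,
  which reduces the claim to Liouville's theorem.\<close>

lemma entire_quasi_periodic_eq_0:
  fixes f :: "complex \<Rightarrow> complex"
  assumes "Im \<tau> > 0" and f: "f holomorphic_on UNIV"
    and f1: "\<And>x. f (x + 1) = f x"
    and f2: "\<And>x. f (x + \<tau>) = exp (- 2 * of_real pi * \<i> * \<zeta>) * f x"
    and \<zeta>: "\<zeta> \<notin> period_lattice \<tau>"
  shows "f x = 0"
proof (rule ccontr)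
  assume nz: "f x \<noteq> 0"
  \<comment> \<open>The real part of it\<tau> - 2\<pi>i\<zeta> is -t Im \<tau> + 2\<pi> Im \<zeta>,
    which this t makes zero.\<close>
  define t where "t = 2 * pi * Im \<zeta> / Im \<tau>"
  define h where "h y = exp (\<i> * of_real t * y) * f y" for y
  have "h holomorphic_on UNIV" unfolding h_def by (intro holomorphic_intros f)
  moreover have "norm (h (y + 1)) = norm (h y)" for y
    by (simp add: h_def norm_mult f1 norm_exp_eq_Re)
  moreover have "norm (h (y + \<tau>)) = norm (h y)" for y
  proof -
    have "h (y + \<tau>) = exp (\<i> * of_real t * \<tau> - 2 * of_real pi * \<i> * \<zeta>) * h y"
    proof -
      have "h (y + \<tau>) = (exp (\<i> * of_real t * (y + \<tau>)) * exp (- 2 * of_real pi * \<i> * \<zeta>)) * f y"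
        by (simp add: h_def f2)
      also have "exp (\<i> * of_real t * (y + \<tau>)) * exp (- 2 * of_real pi * \<i> * \<zeta>)
          = exp (\<i> * of_real t * \<tau> - 2 * of_real pi * \<i> * \<zeta>) * exp (\<i> * of_real t * y)"
        unfolding exp_add[symmetric] by (simp add: algebra_simps)
      finally show ?thesis by (simp add: h_def)
    qed
    moreover have "norm (exp (\<i> * of_real t * \<tau> - 2 * of_real pi * \<i> * \<zeta>)) = 1"
      using assms(1) by (simp add: norm_exp_eq_Re t_def)
    ultimately show ?thesis by (simp add: norm_mult)
  qed
  ultimately obtain c where c: "\<And>y. h y = c"
    using entire_norm_doubly_periodic_imp_constant[OF assms(1)] by blast
  have h_x: "h x \<noteq> 0" using nz by (simp add: h_def)
  have "exp (\<i> * of_real t * y) * f y = exp (\<i> * of_real t * x) * f x" for y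
    using c[of y] c[of x] by (simp add: h_def)
  note eq = this
  \<comment> \<open>A nonzero constant \<open>h\<close> forces both multipliers to be 1. The first
    gives t = 2\<pi>n, and then the second gives \<zeta> = n\<tau> - m, a period.\<close>
  have e: "exp (\<i> * of_real t) = 1" "exp (\<i> * of_real t * \<tau> - 2 * of_real pi * \<i> * \<zeta>) = 1"
    using nz eq[of "x + 1"] eq[of "x + \<tau>"]
    by (simp_all add: f1 f2 exp_add distrib_left exp_diff exp_minus) (simp add: field_simps)
  from e(1) obtain n :: int where n: "t = of_int (2 * n) * pi"
    by (auto simp: exp_eq_1)
  from e(2) obtain m :: int where m: "Im (\<i> * of_real t * \<tau> - 2 * of_real pi * \<i> * \<zeta>) = of_int (2 * m) * pi"
    "Re (\<i> * of_real t * \<tau> - 2 * of_real pi * \<i> * \<zeta>) = 0"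
    by (auto simp: exp_eq_1)
  have "\<zeta> = of_int (- m) + of_int n * \<tau>"
  proof (rule complex_eqI)
    have "(2 * pi) * (Re \<zeta> + of_int m) = (2 * pi) * (of_int n * Re \<tau>)"
      using m(1) n by (simp add: algebra_simps)
    then have "Re \<zeta> + of_int m = of_int n * Re \<tau>"
      by (subst (asm) mult_cancel_left) simp
    then show "Re \<zeta> = Re (of_int (- m) + of_int n * \<tau>)" by simp
    have "(2 * pi) * Im \<zeta> = (2 * pi) * (of_int n * Im \<tau>)"
      using m(2) n by (simp add: algebra_simps)
    then show "Im \<zeta> = Im (of_int (- m) + of_int n * \<tau>)"
      by (subst (asm) mult_cancel_left) simp
  qed
  with \<zeta> show False unfolding period_lattice_def by blast
qed

section \<open>The zeros of theta1\<close>

lemma exp_2pi_i_eq_1_iff: "exp (2 * of_real pi * \<i> * y) = 1 \<longleftrightarrow> (\<exists>m::int. y = of_int m)"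
proof
  assume "exp (2 * of_real pi * \<i> * y) = 1"
  then obtain m :: int where "Im y = 0" "Re y = of_int m"
    by (auto simp: exp_eq_1)
  then have "y = of_int m" by (simp add: complex_eq_iff)
  then show "\<exists>m::int. y = of_int m" by blast
qed (auto simp: exp_eq_1)

text \<open>At a zero of f the product rule leaves f'(z+p) = m(z) f'(z) with m(z) \<noteq> 0. So
  simplicity need only be checked at one point of each class modulo the lattice.\<close>

lemma quasi_period_simple_zero_iff:
  fixes f m :: "complex \<Rightarrow> complex"
  assumes f: "f holomorphic_on UNIV" and m: "m holomorphic_on UNIV" "\<And>x. m x \<noteq> 0"
    and fm: "\<And>x. f (x + p) = m x * f x"
  shows "(f (z + p) = 0 \<and> deriv f (z + p) \<noteq> 0) \<longleftrightarrow> (f z = 0 \<and> deriv f z \<noteq> 0)"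
proof -
  have "(f has_field_derivative deriv f (z + p)) (at (z + p))"
    using f by (simp add: holomorphic_derivI)
  then have 1: "((\<lambda>x. m x * f x) has_field_derivative deriv f (z + p)) (at z)"
    unfolding fm[symmetric] by (simp add: DERIV_shift)
  have 2: "((\<lambda>x. m x * f x) has_field_derivative m z * deriv f z + deriv m z * f z) (at z)"
    using f m by (intro DERIV_mult') (simp_all add: holomorphic_derivI)
  from DERIV_unique[OF 1 2] show ?thesis using m(2) by (auto simp: fm)
qed

text \<open>The product side of the Jacobi triple product, up to a constant factor.\<close>

lemma theta_product_exists:
  assumes "Im \<tau> > 0"
  obtains P where "P holomorphic_on UNIV" "\<And>x. P (x + 1) = - P x"
    "\<And>x. P (x + \<tau>) = - exp (- of_real pi * \<i> * \<tau> - 2 * of_real pi * \<i> * x) * P x"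
    "\<And>x. P x = 0 \<longleftrightarrow> x \<in> period_lattice \<tau>" "deriv P 0 \<noteq> 0"
proof -
  define Q where "Q = exp (2 * of_real pi * \<i> * \<tau>)"
  have Q: "norm Q < 1" unfolding Q_def by (rule exp_2pi_i_tau_norm_less_1[OF assms])
  obtain \<phi> where \<phi>: "\<phi> holomorphic_on UNIV" "\<phi> 0 = 1" and fe: "\<And>w. \<phi> w = (1 - w) * \<phi> (Q * w)"
    using euler_function_exists[OF Q] by blast
  note \<phi>_zero = euler_function_zero_iff[OF Q \<phi> fe]
  have \<phi>_exp: "(\<lambda>x. \<phi> (c * exp (d * x))) holomorphic_on UNIV" for c d
    by (intro entire_compose[OF \<phi>(1)] holomorphic_intros)
  define W where "W x = exp (2 * of_real pi * \<i> * x)" for x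
  \<comment> \<open>With W = exp(2\<pi>ix), the factor \<phi>(W) carries the zeros -n\<tau> + m with
    n \<ge> 0, and \<phi>(Q/W) those with n\<tau> + m, n \<ge> 1.\<close>
  define P where "P x = exp (- of_real pi * \<i> * x) * \<phi> (W x) * \<phi> (Q * exp (- 2 * of_real pi * \<i> * x))" for x
  have W_minus: "exp (- 2 * of_real pi * \<i> * x) = inverse (W x)" for x
    by (simp add: W_def exp_minus)
  have W_nz: "W x \<noteq> 0" for x by (simp add: W_def)
  have P_W: "P x = exp (- of_real pi * \<i> * x) * \<phi> (W x) * \<phi> (Q * inverse (W x))" for x
    by (simp only: P_def W_minus)
  have P_hol: "P holomorphic_on UNIV"
    unfolding P_def W_def by (intro holomorphic_intros entire_compose[OF \<phi>(1)])
  have W1: "W (x + 1) = W x" for x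
    by (simp add: W_def distrib_left exp_add)
  have "exp (- of_real pi * \<i> * (x + 1)) = exp (of_real pi * \<i> * (2 * of_int (-1) + 1)) * exp (- of_real pi * \<i> * x)" for x
    unfolding exp_add[symmetric] by (simp add: algebra_simps)
  then have P1: "P (x + 1) = - P x" for x
    unfolding P_W W1 exp_pi_i_odd by simp
  have W\<tau>: "W (x + \<tau>) = Q * W x" for x
    by (simp add: W_def Q_def distrib_left exp_add)
  have P\<tau>: "P (x + \<tau>) = - exp (- of_real pi * \<i> * \<tau> - 2 * of_real pi * \<i> * x) * P x" for x
  proof -
    have "Q \<noteq> 0" by (simp add: Q_def)
    then have "P (x + \<tau>) = exp (- of_real pi * \<i> * (x + \<tau>)) * \<phi> (Q * W x) * \<phi> (inverse (W x))"
      unfolding P_W W\<tau> by (simp add: mult.assoc[symmetric])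
    \<comment> \<open>The functional equation at 1/W yields the factor 1 - 1/W = -(1-W)/W, and its
      part 1 - W is exactly what turns \<phi>(QW) back into \<phi>(W).\<close>
    also have "\<phi> (inverse (W x)) = - inverse (W x) * (1 - W x) * \<phi> (Q * inverse (W x))"
      by (subst fe) (simp add: algebra_simps W_nz)
    also have "exp (- of_real pi * \<i> * (x + \<tau>)) * \<phi> (Q * W x) * (- inverse (W x) * (1 - W x) * \<phi> (Q * inverse (W x)))
        = - (exp (- of_real pi * \<i> * (x + \<tau>)) * inverse (W x)) * ((1 - W x) * \<phi> (Q * W x)) * \<phi> (Q * inverse (W x))"
      by simp
    also have "(1 - W x) * \<phi> (Q * W x) = \<phi> (W x)" by (rule fe[symmetric])
    also have "exp (- of_real pi * \<i> * (x + \<tau>)) * inverse (W x)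
        = exp (- of_real pi * \<i> * \<tau> - 2 * of_real pi * \<i> * x) * exp (- of_real pi * \<i> * x)"
      unfolding W_minus[symmetric] exp_add[symmetric] by (simp add: algebra_simps)
    finally show ?thesis unfolding P_W by simp
  qed
  have z1: "\<phi> (W x) = 0 \<longleftrightarrow> (\<exists>n::nat. \<exists>m::int. of_nat n * \<tau> + x = of_int m)" for x
  proof -
    have "Q ^ n * W x = exp (2 * of_real pi * \<i> * (of_nat n * \<tau> + x))" for n
      unfolding Q_def W_def exp_of_nat_mult[symmetric] exp_add[symmetric] by (simp add: algebra_simps)
    then show ?thesis unfolding \<phi>_zero by (simp only: exp_2pi_i_eq_1_iff)
  qed
  have z2: "\<phi> (Q * inverse (W x)) = 0 \<longleftrightarrow> (\<exists>n::nat. \<exists>m::int. of_nat (Suc n) * \<tau> - x = of_int m)" for x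
  proof -
    have "Q ^ n * (Q * inverse (W x)) = exp (2 * of_real pi * \<i> * (of_nat (Suc n) * \<tau> - x))" for n
      unfolding W_minus[symmetric] unfolding Q_def exp_of_nat_mult[symmetric] exp_add[symmetric]
      by (simp add: algebra_simps)
    then show ?thesis unfolding \<phi>_zero by (simp only: exp_2pi_i_eq_1_iff)
  qed
  have P_zero: "P x = 0 \<longleftrightarrow> x \<in> period_lattice \<tau>" for x
  proof
    assume "P x = 0"
    then have "\<phi> (W x) = 0 \<or> \<phi> (Q * inverse (W x)) = 0" by (simp add: P_W)
    then show "x \<in> period_lattice \<tau>"
    proof
      assume "\<phi> (W x) = 0"
      then obtain n :: nat and m :: int where "of_nat n * \<tau> + x = of_int m" unfolding z1 by blast
      then have "x = of_int m + of_int (- int n) * \<tau>" by (simp add: algebra_simps)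
      then show ?thesis unfolding period_lattice_def by blast
    next
      assume "\<phi> (Q * inverse (W x)) = 0"
      then obtain n :: nat and m :: int where "of_nat (Suc n) * \<tau> - x = of_int m" unfolding z2 by blast
      then have "x = of_int (- m) + of_int (int (Suc n)) * \<tau>" by (simp add: algebra_simps)
      then show ?thesis unfolding period_lattice_def by blast
    qed
  next
    assume "x \<in> period_lattice \<tau>"
    then obtain a b where x: "x = of_int a + of_int b * \<tau>" by (auto simp: period_lattice_def)
    show "P x = 0"
    proof (cases "b \<le> 0")
      case True
      then have "of_nat (nat (- b)) * \<tau> + x = of_int a" by (simp add: x)
      then have "\<phi> (W x) = 0" unfolding z1 by blast
      then show ?thesis by (simp add: P_W)
    next
      case False
      then have "of_nat (Suc (nat (b - 1))) * \<tau> - x = of_int (- a)"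
        by (simp add: x algebra_simps)
      then have "\<phi> (Q * inverse (W x)) = 0" unfolding z2 by blast
      then show ?thesis by (simp add: P_W)
    qed
  qed
  \<comment> \<open>Splitting the factor 1 - W off \<phi>(W) isolates the zero of P at the origin,
    so P'(0) is a nonzero multiple of g(0) = \<phi>(Q)^2.\<close>
  define g where "g x = exp (- of_real pi * \<i> * x) * \<phi> (Q * exp (2 * of_real pi * \<i> * x)) * \<phi> (Q * exp (- 2 * of_real pi * \<i> * x))" for x
  have P_g: "P = (\<lambda>x. (1 - exp (2 * of_real pi * \<i> * x)) * g x)"
  proof
    fix x
    show "P x = (1 - exp (2 * of_real pi * \<i> * x)) * g x"
      unfolding P_def g_def by (subst fe[of "W x"]) (simp add: W_def)
  qed
  have "g holomorphic_on UNIV"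
    unfolding g_def by (intro holomorphic_intros \<phi>_exp)
  then have "((\<lambda>x. (1 - exp (2 * of_real pi * \<i> * x)) * g x) has_field_derivative
      (1 - exp (2 * of_real pi * \<i> * 0)) * deriv g 0 + (0 - exp (2 * of_real pi * \<i> * 0) * (2 * of_real pi * \<i>)) * g 0) (at 0)"
    by (intro DERIV_mult' derivative_eq_intros refl) (auto simp: holomorphic_derivI)
  then have "deriv P 0 = - (2 * of_real pi * \<i>) * g 0"
    unfolding P_g by (intro DERIV_imp_deriv) simp
  moreover have "g 0 \<noteq> 0"
  proof -
    have "Q ^ Suc n \<noteq> 1" for n
      by (rule power_Suc_neq_1_of_norm_less_1[OF Q])
    then have "\<phi> Q \<noteq> 0" unfolding \<phi>_zero by (simp add: mult.commute)
    then show ?thesis by (simp add: g_def)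
  qed
  ultimately have "deriv P 0 \<noteq> 0" by simp
  with P_hol P1 P\<tau> P_zero show thesis using that by blast
qed

lemma entire_eventually_nonzero:
  fixes p :: "complex \<Rightarrow> complex"
  assumes "p holomorphic_on UNIV" "p \<beta> \<noteq> 0"
  shows "\<forall>\<^sub>F x in at z. p x \<noteq> 0"
  using non_zero_neighbour_alt[OF assms(1) open_UNIV connected_UNIV UNIV_I UNIV_I assms(2)] by simp

text \<open>The ring of entire functions has no zero divisors. This cancels a theta factor from a
  quasi-periodicity relation, including at the zeros of that factor.\<close>

lemma entire_mult_eq_0:
  fixes p h :: "complex \<Rightarrow> complex"
  assumes "p holomorphic_on UNIV" "p \<beta> \<noteq> 0" "h holomorphic_on UNIV" "\<And>x. p x * h x = 0"
  shows "h z = 0"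
proof -
  have "\<forall>\<^sub>F x in at z. h x = 0"
    using entire_eventually_nonzero[OF assms(1,2), of z]
    by eventually_elim (use assms(4) in auto)
  then have "(h \<longlongrightarrow> 0) (at z)" by (rule tendsto_eventually)
  moreover have "(h \<longlongrightarrow> h z) (at z)"
    using entire_imp_isCont[OF assms(3)] by (simp add: isCont_def)
  ultimately show ?thesis using tendsto_unique trivial_limit_at by metis
qed

lemma theta1_lattice:
  assumes "z \<in> period_lattice \<tau>"
  shows "theta1 \<tau> z = 0"
proof -
  obtain a b where z: "z = of_int a + of_int b * \<tau>" using assms by (auto simp: period_lattice_def)
  have "(theta1 \<tau> (0 + of_int a * 1 + of_int b * \<tau>) = 0) \<longleftrightarrow> (theta1 \<tau> (0 + of_int a * 1) = 0)"
    by (rule invariant_add_of_int) (simp add: theta1_add_tau)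
  also have "\<dots> \<longleftrightarrow> theta1 \<tau> 0 = 0"
    by (rule invariant_add_of_int) (simp add: theta1_add_1)
  finally show ?thesis by (simp add: z theta1_0)
qed

lemma theta1_eq_0_iff_and_simple:
  assumes "Im \<tau> > 0"
  shows "theta1 \<tau> x = 0 \<longleftrightarrow> x \<in> period_lattice \<tau>"
    and "theta1 \<tau> x = 0 \<Longrightarrow> deriv (theta1 \<tau>) x \<noteq> 0"
proof -
  obtain P where P: "P holomorphic_on UNIV" "\<And>x. P (x + 1) = - P x"
    "\<And>x. P (x + \<tau>) = - exp (- of_real pi * \<i> * \<tau> - 2 * of_real pi * \<i> * x) * P x"
    "\<And>x. P x = 0 \<longleftrightarrow> x \<in> period_lattice \<tau>" "deriv P 0 \<noteq> 0"
    using theta_product_exists[OF assms] by blast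
  have simple: "deriv P z \<noteq> 0" if Pz: "P z = 0" for z
  proof -
    obtain a b where z: "z = of_int a + of_int b * \<tau>" using Pz by (auto simp: P(4) period_lattice_def)
    let ?S = "\<lambda>z. P z = 0 \<and> deriv P z \<noteq> 0"
    have "?S (0 + of_int a * 1 + of_int b * \<tau>) \<longleftrightarrow> ?S (0 + of_int a * 1)"
      by (rule invariant_add_of_int, rule quasi_period_simple_zero_iff[OF P(1) _ _ P(3)])
         (auto intro!: holomorphic_intros)
    also have "\<dots> \<longleftrightarrow> ?S 0"
      by (rule invariant_add_of_int, rule quasi_period_simple_zero_iff[OF P(1), of "\<lambda>_. -1"])
         (auto simp: P(2))
    finally show ?thesis using P(5) period_lattice_0 by (simp add: z P(4))
  qed
  \<comment> \<open>The division uses that every lattice point is a zero of \<open>theta1\<close>;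
    that there are no others comes out only when g is seen to be a nonzero constant.\<close>
  obtain g where g: "g holomorphic_on UNIV" "\<And>x. theta1 \<tau> x = P x * g x"
    using entire_divide[OF theta1_holomorphic[OF assms] P(1) _ simple] theta1_lattice P(4) by metis
  obtain \<beta> where \<beta>: "theta1 \<tau> \<beta> \<noteq> 0" using theta1_not_identically_0[OF assms] .
  then have P\<beta>: "P \<beta> \<noteq> 0" by (auto simp: g(2))
  have shift: "(\<lambda>x. g (x + c)) holomorphic_on UNIV" for c
    by (intro entire_compose[OF g(1)] holomorphic_intros)
  have "g (x + 1) - g x = 0" for x
  proof (rule entire_mult_eq_0[OF P(1) P\<beta>, where h = "\<lambda>x. g (x + 1) - g x"])
    show "(\<lambda>x. g (x + 1) - g x) holomorphic_on UNIV" by (intro holomorphic_intros shift g(1))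
    show "P x * (g (x + 1) - g x) = 0" for x
      using theta1_add_1[of \<tau> x] by (simp add: g(2) P(2) right_diff_distrib)
  qed
  moreover have "g (x + \<tau>) - g x = 0" for x
  proof (rule entire_mult_eq_0[OF P(1) P\<beta>, where h = "\<lambda>x. g (x + \<tau>) - g x"])
    show "(\<lambda>x. g (x + \<tau>) - g x) holomorphic_on UNIV" by (intro holomorphic_intros shift g(1))
    show "P x * (g (x + \<tau>) - g x) = 0" for x
      using theta1_add_tau[of \<tau> x] by (simp add: g(2) P(3) right_diff_distrib)
  qed
  ultimately obtain c where c: "\<And>x. g x = c"
    using entire_norm_doubly_periodic_imp_constant[OF assms g(1)] by auto
  have eq: "theta1 \<tau> = (\<lambda>x. P x * c)" by (simp add: fun_eq_iff g(2) c)
  have "c \<noteq> 0" using \<beta> by (auto simp: eq)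
  then show "theta1 \<tau> x = 0 \<longleftrightarrow> x \<in> period_lattice \<tau>"
    by (simp add: eq P(4))
  assume "theta1 \<tau> x = 0"
  then have "P x = 0" using \<open>c \<noteq> 0\<close> by (simp add: eq)
  have "(P has_field_derivative deriv P x) (at x)"
    using P(1) by (simp add: holomorphic_derivI)
  then have "((\<lambda>x. P x * c) has_field_derivative deriv P x * c) (at x)"
    by (rule DERIV_cmult_right)
  then show "deriv (theta1 \<tau>) x \<noteq> 0"
    using simple[OF \<open>P x = 0\<close>] \<open>c \<noteq> 0\<close> by (simp add: eq DERIV_imp_deriv)
qed

lemmas theta1_eq_0_iff = theta1_eq_0_iff_and_simple(1)
lemmas theta1_simple_zero = theta1_eq_0_iff_and_simple(2)

lemma theta1_shift_holomorphic:
  assumes "Im \<tau> > 0"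
  shows "(\<lambda>x. theta1 \<tau> (x + c)) holomorphic_on UNIV"
  by (intro entire_compose[OF theta1_holomorphic[OF assms]] holomorphic_intros)

section \<open>Partial fractions\<close>

text \<open>The multipliers are those of the product of all theta1(x-a), times exp(-2\<pi>i\<zeta>)
  along \<tau>. Dividing by one such theta function at a time shortens the list, and the empty list
  is the case of multipliers 1 and exp(-2\<pi>i\<zeta>). Incongruence of the points keeps the
  remaining ones zeros of the quotient.\<close>

lemma entire_theta_type_eq_0:
  fixes f :: "complex \<Rightarrow> complex"
  assumes "Im \<tau> > 0" and "\<zeta> \<notin> period_lattice \<tau>" and "f holomorphic_on UNIV"
    and "\<And>x. f (x + 1) = (-1) ^ length as * f x"
    and "\<And>x. f (x + \<tau>) = (-1) ^ length as * exp (- of_nat (length as) * (of_real pi * \<i> * \<tau>)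
           - 2 * of_real pi * \<i> * (of_nat (length as) * x - sum_list as + \<zeta>)) * f x"
    and "\<And>a. a \<in> set as \<Longrightarrow> f a = 0"
    and "sorted_wrt (\<lambda>a b. b - a \<notin> period_lattice \<tau>) as"
  shows "f x = 0"
  using assms(3-)
proof (induction as arbitrary: f x)
  case Nil
  show ?case
    by (rule entire_quasi_periodic_eq_0[OF assms(1) Nil(1) _ _ assms(2)])
       (use Nil(2,3) in simp_all)
next
  case (Cons a as)
  define n where "n = length as"
  define p where "p x = theta1 \<tau> (x + - a)" for x
  have p: "p holomorphic_on UNIV"
    unfolding p_def by (rule theta1_shift_holomorphic[OF assms(1)])
  have p1: "p (x + 1) = - p x" for x
    using theta1_add_1[of \<tau> "x - a"] by (simp add: p_def algebra_simps)
  have p\<tau>: "p (x + \<tau>) = - exp (- of_real pi * \<i> * \<tau> - 2 * of_real pi * \<i> * (x - a)) * p x" for x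
    using theta1_add_tau[of \<tau> "x - a"] by (simp add: p_def algebra_simps)
  have p0: "p z = 0 \<longleftrightarrow> z - a \<in> period_lattice \<tau>" for z
    using theta1_eq_0_iff[OF assms(1)] by (simp add: p_def)
  have p_simple: "deriv p z \<noteq> 0" if "p z = 0" for z
  proof -
    have "(theta1 \<tau> has_field_derivative deriv (theta1 \<tau>) (z + - a)) (at (z + - a))"
      using theta1_holomorphic[OF assms(1)] by (simp add: holomorphic_derivI)
    then have "(p has_field_derivative deriv (theta1 \<tau>) (z + - a)) (at z)"
      unfolding p_def by (subst (asm) DERIV_shift)
    then have "deriv p z = deriv (theta1 \<tau>) (z + - a)" by (rule DERIV_imp_deriv)
    then show ?thesis using theta1_simple_zero[OF assms(1)] that by (simp add: p_def)
  qed
  have f_zero: "f z = 0" if "p z = 0" for z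
  proof -
    have "z - a \<in> period_lattice \<tau>" using that by (simp add: p0)
    then obtain b c where "z - a = of_int b + of_int c * \<tau>" by (auto simp: period_lattice_def)
    then have z: "z = a + of_int b * 1 + of_int c * \<tau>" by (simp add: algebra_simps)
    have "(f z = 0) \<longleftrightarrow> (f (a + of_int b * 1) = 0)"
      unfolding z by (rule invariant_add_of_int) (subst Cons.prems(3), simp)
    also have "\<dots> \<longleftrightarrow> f a = 0"
      by (rule invariant_add_of_int) (subst Cons.prems(2), simp)
    finally show ?thesis using Cons.prems(4) by simp
  qed
  obtain g where g: "g holomorphic_on UNIV" "\<And>x. f x = p x * g x"
    using entire_divide[OF Cons.prems(1) p f_zero p_simple] by blast
  have shift: "(\<lambda>x. g (x + c)) holomorphic_on UNIV" for c
    by (intro entire_compose[OF g(1)] holomorphic_intros)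
  obtain \<beta>' where "theta1 \<tau> \<beta>' \<noteq> 0" using theta1_not_identically_0[OF assms(1)] .
  then obtain \<beta> where \<beta>: "p \<beta> \<noteq> 0" unfolding p_def by (metis diff_add_cancel uminus_add_conv_diff add.commute)
  \<comment> \<open>The exponential part of the multiplier attached to the shorter list; the
    multiplier of p supplies the missing factor.\<close>
  define e where "e x = exp (- of_nat n * (of_real pi * \<i> * \<tau>) - 2 * of_real pi * \<i> * (of_nat n * x - sum_list as + \<zeta>))" for x
  have "g (x + 1) - (-1) ^ n * g x = 0" for x
  proof (rule entire_mult_eq_0[OF p \<beta>, where h = "\<lambda>x. g (x + 1) - (-1) ^ n * g x"])
    show "(\<lambda>x. g (x + 1) - (-1) ^ n * g x) holomorphic_on UNIV" by (intro holomorphic_intros shift g(1))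
    show "p x * (g (x + 1) - (-1) ^ n * g x) = 0" for x
      using Cons.prems(2)[of x] by (simp add: g(2) p1 n_def right_diff_distrib mult.left_commute)
  qed
  then have g1: "g (x + 1) = (-1) ^ n * g x" for x by simp
  have "g (x + \<tau>) - (-1) ^ n * e x * g x = 0" for x
  proof (rule entire_mult_eq_0[OF p \<beta>, where h = "\<lambda>x. g (x + \<tau>) - (-1) ^ n * e x * g x"])
    show "(\<lambda>x. g (x + \<tau>) - (-1) ^ n * e x * g x) holomorphic_on UNIV"
      unfolding e_def by (intro holomorphic_intros shift g(1))
    show "p x * (g (x + \<tau>) - (-1) ^ n * e x * g x) = 0" for x
    proof -
      let ?m = "exp (- of_real pi * \<i> * \<tau> - 2 * of_real pi * \<i> * (x - a))"
      have "?m * e x = exp (- of_nat (length (a # as)) * (of_real pi * \<i> * \<tau>)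
           - 2 * of_real pi * \<i> * (of_nat (length (a # as)) * x - sum_list (a # as) + \<zeta>))"
        unfolding e_def exp_add[symmetric] by (intro arg_cong[of _ _ exp]) (simp add: n_def algebra_simps)
      then have "f (x + \<tau>) = - ((-1) ^ n) * (?m * e x) * f x"
        using Cons.prems(3)[of x] by (simp add: n_def)
      then have "?m * (p x * (g (x + \<tau>) - (-1) ^ n * e x * g x)) = 0"
        by (simp add: g(2) p\<tau> right_diff_distrib mult_ac)
      then show ?thesis by simp
    qed
  qed
  then have g\<tau>: "g (x + \<tau>) = (-1) ^ n * e x * g x" for x by simp
  have "g x = 0"
  proof (rule Cons.IH[OF g(1)])
    show "g (x + 1) = (-1) ^ length as * g x" for x using g1 by (simp add: n_def)
    show "g (x + \<tau>) = (-1) ^ length as * exp (- of_nat (length as) * (of_real pi * \<i> * \<tau>)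
           - 2 * of_real pi * \<i> * (of_nat (length as) * x - sum_list as + \<zeta>)) * g x" for x
      using g\<tau> by (simp add: n_def e_def)
    show "g b = 0" if "b \<in> set as" for b
      using Cons.prems(4,5) that p0[of b] by (auto simp: g(2))
    show "sorted_wrt (\<lambda>a b. b - a \<notin> period_lattice \<tau>) as" using Cons.prems(5) by simp
  qed
  then show ?case by (simp add: g(2))
qed

lemma theta1_triple_add_1:
  "theta1 \<tau> (x + 1 + u) * theta1 \<tau> (x + 1 + v) * theta1 \<tau> (x + 1 + w)
   = - (theta1 \<tau> (x + u) * theta1 \<tau> (x + v) * theta1 \<tau> (x + w))"
  using theta1_add_1[of \<tau> "x + u"] theta1_add_1[of \<tau> "x + v"] theta1_add_1[of \<tau> "x + w"]
  by (simp add: algebra_simps)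

text \<open>The multiplier of a product of three shifted theta functions depends on the shifts only
  through their sum, so products with equal sums may be added.\<close>

lemma theta1_triple_add_tau:
  assumes "u + v + w = c"
  shows "theta1 \<tau> (x + \<tau> + u) * theta1 \<tau> (x + \<tau> + v) * theta1 \<tau> (x + \<tau> + w)
   = - exp (- 3 * (of_real pi * \<i> * \<tau>) - 2 * of_real pi * \<i> * (3 * x + c))
       * (theta1 \<tau> (x + u) * theta1 \<tau> (x + v) * theta1 \<tau> (x + w))"
proof -
  have shift: "theta1 \<tau> (x + \<tau> + y) = - exp (- of_real pi * \<i> * \<tau> - 2 * of_real pi * \<i> * (x + y)) * theta1 \<tau> (x + y)" for y
    using theta1_add_tau[of \<tau> "x + y"] by (simp add: algebra_simps)
  have "exp (- of_real pi * \<i> * \<tau> - 2 * of_real pi * \<i> * (x + u)) * exp (- of_real pi * \<i> * \<tau> - 2 * of_real pi * \<i> * (x + v))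
      * exp (- of_real pi * \<i> * \<tau> - 2 * of_real pi * \<i> * (x + w))
      = exp (- 3 * (of_real pi * \<i> * \<tau>) - 2 * of_real pi * \<i> * (3 * x + c))"
    unfolding exp_add[symmetric] assms[symmetric] by (intro arg_cong[of _ _ exp]) (simp add: algebra_simps)
  from this[symmetric] show ?thesis unfolding shift by simp
qed

text \<open>Clearing denominators leaves a combination of four triple theta products. Because u + v
  = a + b they have the same multipliers. The three coefficients are chosen to make the combination
  vanish at a, b and c, hence everywhere.\<close>

lemma Phi_partial_fraction:
  assumes "Im \<tau> > 0" and "\<zeta> \<notin> period_lattice \<tau>" and uv: "u + v = a + b"
    and ab: "b - a \<notin> period_lattice \<tau>" and ac: "c - a \<notin> period_lattice \<tau>"
    and bc: "c - b \<notin> period_lattice \<tau>"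
    and x: "x - a \<notin> period_lattice \<tau>" "x - b \<notin> period_lattice \<tau>" "x - c \<notin> period_lattice \<tau>"
  shows "theta1 \<tau> (x - u) * theta1 \<tau> (x - v) / (theta1 \<tau> (x - a) * theta1 \<tau> (x - b)) * Phi \<tau> (x - c) \<zeta>
    = theta1 \<tau> (a - u) * theta1 \<tau> (a - v) / theta1 \<tau> (a - b) * Phi \<tau> (a - c) \<zeta> * Phi \<tau> (x - a) \<zeta>
    + theta1 \<tau> (b - u) * theta1 \<tau> (b - v) / theta1 \<tau> (b - a) * Phi \<tau> (b - c) \<zeta> * Phi \<tau> (x - b) \<zeta>
    + theta1 \<tau> (c - u) * theta1 \<tau> (c - v) / (theta1 \<tau> (c - a) * theta1 \<tau> (c - b)) * Phi \<tau> (x - c) \<zeta>"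
proof -
  note z = theta1_eq_0_iff[OF assms(1)]
  have swap: "a - b \<notin> period_lattice \<tau>" "a - c \<notin> period_lattice \<tau>" "b - c \<notin> period_lattice \<tau>"
    using period_lattice_minus_iff[of "b - a" \<tau>] period_lattice_minus_iff[of "c - a" \<tau>]
      period_lattice_minus_iff[of "c - b" \<tau>] ab ac bc by simp_all
  have nz: "theta1 \<tau> (b - a) \<noteq> 0" "theta1 \<tau> (c - a) \<noteq> 0" "theta1 \<tau> (c - b) \<noteq> 0"
    "theta1 \<tau> (a - b) \<noteq> 0" "theta1 \<tau> (a - c) \<noteq> 0" "theta1 \<tau> (b - c) \<noteq> 0" "theta1 \<tau> \<zeta> \<noteq> 0"
    "theta1 \<tau> (x - a) \<noteq> 0" "theta1 \<tau> (x - b) \<noteq> 0" "theta1 \<tau> (x - c) \<noteq> 0"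
    using ab ac bc swap x assms(2) by (simp_all add: z)
  define A where "A = theta1 \<tau> (a - u) * theta1 \<tau> (a - v) / theta1 \<tau> (a - b) * Phi \<tau> (a - c) \<zeta>"
  define B where "B = theta1 \<tau> (b - u) * theta1 \<tau> (b - v) / theta1 \<tau> (b - a) * Phi \<tau> (b - c) \<zeta>"
  define C where "C = theta1 \<tau> (c - u) * theta1 \<tau> (c - v) / (theta1 \<tau> (c - a) * theta1 \<tau> (c - b))"
  define T where "T u v w x = theta1 \<tau> (x + u) * theta1 \<tau> (x + v) * theta1 \<tau> (x + w)" for u v w x
  \<comment> \<open>The difference of the two sides times theta1(x-a) theta1(x-b) theta1(x-c)
    theta1(\<zeta>).\<close>
  define N where "N x = T (-u) (-v) (\<zeta> - c) x - A * T (\<zeta> - a) (-b) (-c) x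
      - B * T (-a) (\<zeta> - b) (-c) x - C * T (-a) (-b) (\<zeta> - c) x" for x
  have T1: "T u v w (x + 1) = - T u v w x" for u v w x
    unfolding T_def by (rule theta1_triple_add_1)
  have T\<tau>: "T u v w (x + \<tau>) = - exp (- 3 * (of_real pi * \<i> * \<tau>) - 2 * of_real pi * \<i> * (3 * x + (\<zeta> - a - b - c))) * T u v w x"
    if "u + v + w = \<zeta> - a - b - c" for u v w x
    unfolding T_def by (rule theta1_triple_add_tau[OF that])
  have "N x = 0"
  proof (rule entire_theta_type_eq_0[OF assms(1,2), where f = N and as = "[a, b, c]"])
    show "N holomorphic_on UNIV"
      unfolding N_def T_def by (intro holomorphic_intros theta1_shift_holomorphic[OF assms(1)])
    show "N (x + 1) = (-1) ^ length [a, b, c] * N x" for x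
      by (simp add: N_def T1)
    show "N (x + \<tau>) = (-1) ^ length [a, b, c] * exp (- of_nat (length [a, b, c]) * (of_real pi * \<i> * \<tau>)
           - 2 * of_real pi * \<i> * (of_nat (length [a, b, c]) * x - sum_list [a, b, c] + \<zeta>)) * N x" for x
    proof -
      have c: "- u + - v + (\<zeta> - c) = \<zeta> - a - b - c" "\<zeta> - a + - b + - c = \<zeta> - a - b - c"
        "- a + (\<zeta> - b) + - c = \<zeta> - a - b - c" "- a + - b + (\<zeta> - c) = \<zeta> - a - b - c"
        using uv by (simp_all add: algebra_simps)
      have e: "- 3 * (of_real pi * \<i> * \<tau>) - 2 * of_real pi * \<i> * (3 * x + (\<zeta> - a - b - c))
        = - of_nat (length [a, b, c]) * (of_real pi * \<i> * \<tau>)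
           - 2 * of_real pi * \<i> * (of_nat (length [a, b, c]) * x - sum_list [a, b, c] + \<zeta>)"
        by (simp add: algebra_simps)
      show ?thesis
        unfolding N_def T\<tau>[OF c(1)] T\<tau>[OF c(2)] T\<tau>[OF c(3)] T\<tau>[OF c(4)] e
        by (simp add: right_diff_distrib)
    qed
    have "N a = 0"
      using nz by (simp add: N_def T_def A_def Phi_def theta1_0 field_simps)
    moreover have "N b = 0"
      using nz by (simp add: N_def T_def B_def Phi_def theta1_0 field_simps)
    moreover have "N c = 0"
      using nz by (simp add: N_def T_def C_def theta1_0 field_simps)
    ultimately show "\<And>d. d \<in> set [a, b, c] \<Longrightarrow> N d = 0" by auto
    show "sorted_wrt (\<lambda>a b. b - a \<notin> period_lattice \<tau>) [a, b, c]"
      using ab ac bc by simp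
  qed
  then have "theta1 \<tau> (x - u) * theta1 \<tau> (x - v) / (theta1 \<tau> (x - a) * theta1 \<tau> (x - b)) * Phi \<tau> (x - c) \<zeta>
    = A * Phi \<tau> (x - a) \<zeta> + B * Phi \<tau> (x - b) \<zeta> + C * Phi \<tau> (x - c) \<zeta>"
    using nz by (simp add: N_def T_def Phi_def field_simps)
  then show ?thesis by (simp only: A_def B_def C_def)
qed

section \<open>Linear independence of translates of Phi\<close>

lemma eventually_add_not_in_period_lattice:
  assumes "Im \<tau> > 0"
  shows "\<forall>\<^sub>F x in at z. x + a \<notin> period_lattice \<tau>"
proof -
  obtain \<beta> where "theta1 \<tau> \<beta> \<noteq> 0" using theta1_not_identically_0[OF assms] .
  then have "theta1 \<tau> ((\<beta> - a) + a) \<noteq> 0" by simp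
  from entire_eventually_nonzero[OF theta1_shift_holomorphic[OF assms] this, of z]
  show ?thesis by (simp add: theta1_eq_0_iff[OF assms])
qed

text \<open>Multiplying by theta1(x - p_i) and letting x tend to p_i kills all other terms and
  leaves r_i. The relation is asked for in a punctured neighbourhood because at the pole itself
  division by zero gives a meaningless value.\<close>

lemma Phi_linearly_independent:
  fixes p r :: "'a \<Rightarrow> complex"
  assumes "Im \<tau> > 0" and "\<zeta> \<notin> period_lattice \<tau>" and J: "finite J" "i \<in> J"
    and dist: "\<And>j. j \<in> J \<Longrightarrow> j \<noteq> i \<Longrightarrow> p i - p j \<notin> period_lattice \<tau>"
    and ev: "\<forall>\<^sub>F x in at (p i). (\<Sum>j\<in>J. r j * Phi \<tau> (x - p j) \<zeta>) = 0"
  shows "r i = 0"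
proof -
  note z = theta1_eq_0_iff[OF assms(1)]
  define h where "h x = r i * theta1 \<tau> (\<zeta> + (x - p i)) / theta1 \<tau> \<zeta>
      + theta1 \<tau> (x - p i) * (\<Sum>j\<in>J-{i}. r j * Phi \<tau> (x - p j) \<zeta>)" for x
  have \<zeta>: "theta1 \<tau> \<zeta> \<noteq> 0" using assms(2) by (simp add: z)
  have "\<forall>\<^sub>F x in at (p i). x - p i \<notin> period_lattice \<tau>"
    using eventually_add_not_in_period_lattice[OF assms(1), of "- p i" "p i"] by simp
  with ev have "\<forall>\<^sub>F x in at (p i). h x = 0"
  proof eventually_elim
    case (elim x)
    have "theta1 \<tau> (x - p i) * (\<Sum>j\<in>J. r j * Phi \<tau> (x - p j) \<zeta>) = h x"
      using J elim(2) \<zeta> by (subst sum.remove[of _ i]) (auto simp: h_def Phi_def z field_simps)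
    then show ?case using elim(1) by simp
  qed
  then have "(h \<longlongrightarrow> 0) (at (p i))" by (rule tendsto_eventually)
  moreover have "(h \<longlongrightarrow> h (p i)) (at (p i))"
  proof -
    have \<theta>: "isCont (\<lambda>x. theta1 \<tau> (x - c)) y" "isCont (\<lambda>x. theta1 \<tau> (\<zeta> + (x - c))) y" for c y
      by (intro entire_imp_isCont entire_compose[OF theta1_holomorphic[OF assms(1)]] holomorphic_intros)+
    have "isCont (\<lambda>x. Phi \<tau> (x - p j) \<zeta>) (p i)" if "j \<in> J - {i}" for j
      unfolding Phi_def using dist[of j] that \<zeta>
      by (intro continuous_intros \<theta>) (auto simp: z)
    then have "isCont h (p i)"
      unfolding h_def using \<zeta> by (intro continuous_intros \<theta>) auto
    then show ?thesis by (simp add: isCont_def)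
  qed
  ultimately have "h (p i) = 0" using tendsto_unique trivial_limit_at by metis
  then show ?thesis using \<zeta> by (simp add: h_def theta1_0)
qed

section \<open>Tridiagonal determinants\<close>

text \<open>Both off-diagonals are indexed by the smaller of the two indices, so b n and c n couple
  n with n+1. Entries do not depend on the size, which makes leading blocks matrices of the same
  family.\<close>

definition tridiag_mat :: "(nat \<Rightarrow> 'a::comm_ring_1) \<Rightarrow> (nat \<Rightarrow> 'a) \<Rightarrow> (nat \<Rightarrow> 'a) \<Rightarrow> nat \<Rightarrow> 'a mat" where
  "tridiag_mat a b c n =
     mat n n (\<lambda>(i, j). if i = j then a i else if j = Suc i then b i else if i = Suc j then c j else 0)"

text \<open>Expansion along the last row. The minor belonging to c n has b n as the only nonzero
  entry of its last column, and expanding there reaches the block of size n.\<close>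

lemma det_tridiag_mat_rec:
  "det (tridiag_mat a b c (Suc (Suc n)))
   = a (Suc n) * det (tridiag_mat a b c (Suc n)) - b n * c n * det (tridiag_mat a b c n)"
proof -
  let ?A = "tridiag_mat a b c (Suc (Suc n))"
  define M where "M = mat_delete ?A (Suc n) n"
  have carrier: "?A \<in> carrier_mat (Suc (Suc n)) (Suc (Suc n))" "M \<in> carrier_mat (Suc n) (Suc n)"
    by (simp_all add: tridiag_mat_def M_def mat_delete_def)
  have "det M = (\<Sum>i<Suc n. M $$ (i, n) * cofactor M i n)"
    by (rule laplace_expansion_column[OF carrier(2)]) simp
  also have "\<dots> = (\<Sum>i<n. M $$ (i, n) * cofactor M i n) + M $$ (n, n) * cofactor M n n"
    by simp
  also have "(\<Sum>i<n. M $$ (i, n) * cofactor M i n) = 0"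
    by (intro sum.neutral) (auto simp: M_def mat_delete_def tridiag_mat_def)
  also have "M $$ (n, n) = b n"
    by (simp add: M_def mat_delete_def tridiag_mat_def)
  also have "cofactor M n n = det (tridiag_mat a b c n)"
  proof -
    have "mat_delete M n n = tridiag_mat a b c n"
      by (rule eq_matI) (auto simp: M_def mat_delete_def tridiag_mat_def)
    then show ?thesis by (simp add: cofactor_def)
  qed
  finally have M: "det M = b n * det (tridiag_mat a b c n)" by simp
  have del: "mat_delete ?A (Suc n) (Suc n) = tridiag_mat a b c (Suc n)"
    by (rule eq_matI) (auto simp: mat_delete_def tridiag_mat_def)
  have "det ?A = (\<Sum>j<Suc (Suc n). ?A $$ (Suc n, j) * cofactor ?A (Suc n) j)"
    by (rule laplace_expansion_row[OF carrier(1)]) simp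
  also have "\<dots> = (\<Sum>j<n. ?A $$ (Suc n, j) * cofactor ?A (Suc n) j)
      + ?A $$ (Suc n, n) * cofactor ?A (Suc n) n + ?A $$ (Suc n, Suc n) * cofactor ?A (Suc n) (Suc n)"
    by simp
  also have "(\<Sum>j<n. ?A $$ (Suc n, j) * cofactor ?A (Suc n) j) = 0"
    by (intro sum.neutral) (auto simp: tridiag_mat_def)
  also have "cofactor ?A (Suc n) n = - (b n * det (tridiag_mat a b c n))"
    unfolding cofactor_def M_def[symmetric] M by simp
  also have "cofactor ?A (Suc n) (Suc n) = det (tridiag_mat a b c (Suc n))"
    unfolding cofactor_def del by simp
  also have "?A $$ (Suc n, n) = c n" by (simp add: tridiag_mat_def)
  also have "?A $$ (Suc n, Suc n) = a (Suc n)" by (simp add: tridiag_mat_def)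
  finally show ?thesis by (simp add: algebra_simps)
qed

text \<open>With indices from 0, a superdiagonal entry in row i stands for row i+1 of the original,
  but a subdiagonal entry in column j stands for row j+2.\<close>

lemma lame_matrix_eq_tridiag:
  "lame_matrix \<tau> \<eta> l = tridiag_mat (\<lambda>_. [:0, 1:])
     (\<lambda>i. [:ell_num \<tau> \<eta> (- 1 - int i) / ell_num \<tau> \<eta> (int l - int i):])
     (\<lambda>j. [:ell_num \<tau> \<eta> (2 * int l - int j) / ell_num \<tau> \<eta> (int l - 1 - int j):])"
  by (intro ext eq_matI) (auto simp: lame_matrix_def tridiag_mat_def Let_def algebra_simps)

lemma det_lame_matrix_0: "det (lame_matrix \<tau> \<eta> l 0) = 1"
  by (rule det_dim_zero) (simp add: lame_matrix_def)

lemma det_lame_matrix_1: "det (lame_matrix \<tau> \<eta> l (Suc 0)) = [:0, 1:]"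
  by (subst det_single) (simp_all add: lame_matrix_def)

lemma det_lame_matrix_rec:
  "det (lame_matrix \<tau> \<eta> l (Suc (Suc s))) = pCons 0 (det (lame_matrix \<tau> \<eta> l (Suc s)))
     - Polynomial.smult (ell_num \<tau> \<eta> (- 1 - int s) / ell_num \<tau> \<eta> (int l - int s)
         * (ell_num \<tau> \<eta> (2 * int l - int s) / ell_num \<tau> \<eta> (int l - 1 - int s))) (det (lame_matrix \<tau> \<eta> l s))"
  unfolding lame_matrix_eq_tridiag det_tridiag_mat_rec by (simp add: mult.commute)

text \<open>The recurrence multiplies the previous determinant by the indeterminate and adds a term
  of degree lower by two.\<close>

lemma degree_det_lame_matrix: "degree (det (lame_matrix \<tau> \<eta> l s)) = s"
proof (induction s rule: less_induct)
  case (less s)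
  consider "s = 0" | "s = Suc 0" | s' where "s = Suc (Suc s')" by (metis not0_implies_Suc)
  then show ?case
  proof cases
    case 3
    let ?D = "\<lambda>s. det (lame_matrix \<tau> \<eta> l s)"
    have "degree (?D s') = s'" "degree (?D (Suc s')) = Suc s'" using less 3 by auto
    moreover from this have "?D (Suc s') \<noteq> 0" by fastforce
    ultimately show ?thesis unfolding 3 det_lame_matrix_rec diff_conv_add_uminus
      by (subst degree_add_eq_left) (auto intro: le_less_trans[OF degree_smult_le])
  qed (simp_all add: det_lame_matrix_0 det_lame_matrix_1)
qed

section \<open>The difference Lame equation\<close>

text \<open>The coefficient s_j contributes at index j+1 \<ge> 2, so the indices 0 and 1 have to be
  set apart.\<close>

lemma sum_split_first_two:
  fixes f :: "nat \<Rightarrow> 'a::comm_monoid_add"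
  shows "sum f {0..l+1} = f 0 + (f 1 + (\<Sum>j=1..l. f (Suc j)))"
proof -
  have "sum f {0..l+1} = f 0 + sum f {Suc 0..Suc l}"
    by (simp add: sum.atLeast_Suc_atMost del: sum.cl_ivl_Suc)
  also have "sum f {Suc 0..Suc l} = (\<Sum>j=0..l. f (Suc j))"
    by (rule sum.shift_bounds_cl_Suc_ivl)
  also have "\<dots> = f 1 + (\<Sum>j=1..l. f (Suc j))"
    by (simp add: sum.atLeast_Suc_atMost)
  finally show ?thesis .
qed

locale generic_elliptic =
  fixes \<tau> \<eta> :: complex
  assumes Im_tau: "Im \<tau> > 0"
    and generic: "m \<noteq> 0 \<Longrightarrow> of_int m * \<eta> \<notin> period_lattice \<tau>"
begin

abbreviation \<theta> :: "complex \<Rightarrow> complex" where "\<theta> \<equiv> theta1 \<tau>"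
abbreviation en :: "int \<Rightarrow> complex" where "en \<equiv> ell_num \<tau> \<eta>"
abbreviation eb :: "nat \<Rightarrow> nat \<Rightarrow> complex" where "eb \<equiv> ell_binom \<tau> \<eta>"

section \<open>Elliptic numbers and binomials\<close>

lemma theta_eta_nonzero: "\<theta> \<eta> \<noteq> 0"
  using generic[of 1] theta1_eq_0_iff[OF Im_tau] by simp

lemma theta_eq_ell_num: "\<theta> (of_int j * \<eta>) = \<theta> \<eta> * en j"
  using theta_eta_nonzero by (simp add: ell_num_def)

lemma ell_num_0 [simp]: "en 0 = 0"
  by (simp add: ell_num_def theta1_0)

lemma ell_num_1 [simp]: "en 1 = 1"
  using theta_eta_nonzero by (simp add: ell_num_def)

lemma ell_num_minus: "en (- j) = - en j"
  using theta1_minus[of \<tau> "of_int j * \<eta>"] by (simp add: ell_num_def)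

lemma ell_num_eq_0_iff [simp]: "en j = 0 \<longleftrightarrow> j = 0"
proof
  assume "en j = 0"
  then have "of_int j * \<eta> \<in> period_lattice \<tau>"
    using theta_eta_nonzero by (simp add: ell_num_def theta1_eq_0_iff[OF Im_tau])
  then show "j = 0" using generic by blast
qed simp

lemma ell_fact_nonzero [simp]: "ell_fact \<tau> \<eta> n \<noteq> 0"
  by (simp add: ell_fact_def)

lemma ell_fact_Suc: "ell_fact \<tau> \<eta> (Suc n) = ell_fact \<tau> \<eta> n * en (int (Suc n))"
  by (simp add: ell_fact_def del: of_nat_Suc)

lemma ell_binom_nonzero [simp]: "eb n m \<noteq> 0"
  by (simp add: ell_binom_def)

lemma ell_binom_0 [simp]: "eb n 0 = 1"
  by (simp add: ell_binom_def) (simp add: ell_fact_def)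

lemma ell_binom_self [simp]: "eb n n = 1"
  by (simp add: ell_binom_def) (simp add: ell_fact_def)

lemma ell_binom_Suc:
  assumes "m < n"
  shows "eb n (Suc m) * en (int (Suc m)) = eb n m * en (int n - int m)"
proof -
  have "n - m = Suc (n - Suc m)" using assms by simp
  then have f: "ell_fact \<tau> \<eta> (n - m) = ell_fact \<tau> \<eta> (n - Suc m) * en (int n - int m)"
    using ell_fact_Suc[of "n - Suc m"] assms by (simp add: of_nat_diff)
  have "en (int (Suc m)) \<noteq> 0" "en (int n - int m) \<noteq> 0" using assms by auto
  then show ?thesis
    unfolding ell_binom_def f ell_fact_Suc by (simp add: field_simps del: of_nat_Suc ell_num_eq_0_iff)
qed

lemma ell_binom_Suc_Suc:
  "eb (Suc n) (Suc j) * en (int (Suc j)) = en (int (Suc n)) * eb n j"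
proof -
  have "en (int (Suc j)) \<noteq> 0" by auto
  then show ?thesis
    unfolding ell_binom_def ell_fact_Suc by (simp add: field_simps del: of_nat_Suc ell_num_eq_0_iff)
qed

section \<open>The polynomials A_j\<close>

lemma degree_lame_poly: "j \<le> l \<Longrightarrow> degree (lame_poly \<tau> \<eta> l j) = l - j"
  by (simp add: lame_poly_def Let_def degree_det_lame_matrix)

lemma lame_poly_self: "lame_poly \<tau> \<eta> l l = 1"
  by (simp add: lame_poly_def det_lame_matrix_0)

text \<open>The continuant recurrence of the determinants in s = l - j, rescaled. The normalising
  quotient N of binomials satisfies N(s+1)[2l-s] = N(s)[l-s], which absorbs the denominators of the
  off-diagonal product.\<close>

lemma lame_poly_recurrence:
  assumes "1 \<le> m" "m \<le> l"
  shows "en (int l + int m) * poly (lame_poly \<tau> \<eta> l (m - 1)) E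
    = E * en (int m) * poly (lame_poly \<tau> \<eta> l m) E + en (int l - int m) * poly (lame_poly \<tau> \<eta> l (m + 1)) E"
proof -
  define N where "N s = eb l s * inverse (eb (2 * l) s)" for s
  define D where "D s = poly (det (lame_matrix \<tau> \<eta> l s)) E" for s
  have A: "poly (lame_poly \<tau> \<eta> l j) E = N (l - j) * D (l - j)" for j
    by (simp add: lame_poly_def Let_def N_def D_def)
  have N_Suc: "N (Suc s) * en (2 * int l - int s) = N s * en (int l - int s)" if "s < l" for s
  proof -
    define e1 where "e1 = en (int (Suc s))"
    define e2 where "e2 = en (2 * int l - int s)"
    define e3 where "e3 = en (int l - int s)"
    have nz: "e1 \<noteq> 0" "e2 \<noteq> 0" "e3 \<noteq> 0" using that by (auto simp: e1_def e2_def e3_def)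
    have 1: "eb l (Suc s) = eb l s * e3 / e1"
      using ell_binom_Suc[of s l] that nz(1) unfolding e1_def e3_def by (metis nonzero_eq_divide_eq)
    have 2: "eb (2 * l) (Suc s) = eb (2 * l) s * e2 / e1"
      using ell_binom_Suc[of s "2 * l"] that nz(1) unfolding e1_def e2_def
      by (simp add: nonzero_eq_divide_eq del: ell_num_eq_0_iff)
    show ?thesis
      unfolding N_def 1 2 e2_def[symmetric] e3_def[symmetric] using nz by (simp add: field_simps)
  qed
  show ?thesis
  proof (cases "m = l")
    \<comment> \<open>For m = l, truncated subtraction makes the polynomial with index l+1 equal to
      1; its factor [l-m] = [0] removes it.\<close>
    case True
    with assms have "N 1 * en (2 * int l) = N 0 * en (int l)" using N_Suc[of 0] by simp
    moreover have "int l + int l = 2 * int l" "l - (l - 1) = 1" using assms True by auto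
    moreover have "D 1 = E" "D 0 = 1"
      by (simp_all add: D_def det_lame_matrix_0 det_lame_matrix_1)
    ultimately show ?thesis using True by (simp add: A mult_ac)
  next
    case False
    define s where "s = l - Suc m"
    have m: "m = l - Suc s" "s + m + 1 = l" using False assms by (auto simp: s_def)
    have idx: "l - (m - 1) = Suc (Suc s)" "l - m = Suc s" "l - (m + 1) = s"
      using m(2) assms by auto
    have ints: "int l + int m = 2 * int l - int (Suc s)" "int m = int l - int (Suc s)" "int l - int m = int (Suc s)"
      "int l - 1 - int s = int l - int (Suc s)" "- 1 - int s = - int (Suc s)"
      using m(2) by auto
    define e1 where "e1 = en (int (Suc s))"
    define e2 where "e2 = en (2 * int l - int s)"
    define e3 where "e3 = en (int l - int s)"
    define e4 where "e4 = en (int l - int (Suc s))"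
    have nz: "e3 \<noteq> 0" "e4 \<noteq> 0" using m(2) assms by (auto simp: e3_def e4_def)
    have D: "D (Suc (Suc s)) = E * D (Suc s) + e1 * e2 / (e3 * e4) * D s"
      unfolding D_def det_lame_matrix_rec ints(4,5) ell_num_minus
      by (simp add: e1_def e2_def e3_def e4_def)
    have N1: "N (Suc (Suc s)) * en (2 * int l - int (Suc s)) = N (Suc s) * e4"
      unfolding e4_def using m(2) assms by (intro N_Suc) simp
    have N2: "N (Suc s) * e2 = N s * e3"
      unfolding e2_def e3_def using m(2) by (intro N_Suc) simp
    have "en (int l + int m) * poly (lame_poly \<tau> \<eta> l (m - 1)) E
        = (N (Suc (Suc s)) * en (2 * int l - int (Suc s))) * D (Suc (Suc s))"
      unfolding A idx ints(1) by simp
    also have "\<dots> = N (Suc s) * e4 * E * D (Suc s) + e1 * (N (Suc s) * e2) * D s / e3"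
      unfolding N1 D using nz by (simp add: field_simps)
    also have "\<dots> = E * e4 * (N (Suc s) * D (Suc s)) + e1 * (N s * D s)"
      unfolding N2 using nz by simp
    finally show ?thesis
      unfolding A idx ints(3) e1_def e4_def using ints(2) by simp
  qed
qed

text \<open>Up to normalisation, the residue at \<open>m \<eta>\<close> of the left-hand side minus the right-hand side
  of the Lame equation for the ansatz with coefficients \<open>s\<close>. For \<open>m \<le> 1\<close> the third summand vanishes
  because \<open>s 0 = 0\<close> in all uses.\<close>

definition lame_residue :: "nat \<Rightarrow> complex \<Rightarrow> complex \<Rightarrow> complex \<Rightarrow> (nat \<Rightarrow> complex) \<Rightarrow> nat \<Rightarrow> complex" where
  "lame_residue l E K \<zeta> s m = K * s (m + 1) - E * s m
     + inverse K * (en (int m + int l) * en (int m - int l - 1) / (en (int m) * en (int m - 1))) * s (m - 1)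
     + (if m = 0 then inverse K * (\<theta> \<eta> * en (int l) * en (int l + 1))
          * (\<Sum>j=1..l. s j * Phi \<tau> (- of_nat (j + 1) * \<eta>) \<zeta>) else 0)
     - (if m = 1 then inverse K * (\<theta> \<eta> * en (int l) * en (int l + 1))
          * (\<Sum>j=1..l. s j * Phi \<tau> (- of_nat j * \<eta>) \<zeta>) else 0)"

text \<open>Extension by 0 encodes the boundary values s_0 = s_(l+1) = 0. Beyond l it overrides
  \<open>ell_binom\<close> and \<open>lame_poly\<close>, whose truncated subtractions would give
  nonzero values there.\<close>

definition lame_coeffs :: "nat \<Rightarrow> complex \<Rightarrow> complex \<Rightarrow> nat \<Rightarrow> complex" where
  "lame_coeffs l E K m = (if 1 \<le> m \<and> m \<le> l
     then (- inverse K) ^ m * en (int m) * eb l m * poly (lame_poly \<tau> \<eta> l m) E else 0)"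

text \<open>Using [m+1][l; m+1] = [l-m][l; m], this form also covers m = l, where [l-m] = 0 produces
  the boundary value.\<close>

lemma lame_coeffs_Suc:
  assumes "m \<le> l"
  shows "lame_coeffs l E K (Suc m)
    = (- inverse K) ^ Suc m * eb l m * en (int l - int m) * poly (lame_poly \<tau> \<eta> l (Suc m)) E"
proof (cases "m = l")
  case False
  then have "m < l" using assms by simp
  from ell_binom_Suc[OF this] have "en (int (Suc m)) * eb l (Suc m) = eb l m * en (int l - int m)"
    by (simp add: mult.commute)
  then show ?thesis using \<open>m < l\<close> by (simp add: lame_coeffs_def mult.assoc del: of_nat_Suc power_Suc)
qed (simp add: lame_coeffs_def)

text \<open>All three terms of the residue share the factor (-1/K)^m [l; m]; what remains is the
  recurrence for the polynomials.\<close>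

lemma lame_residue_coeffs:
  assumes "K \<noteq> 0" "2 \<le> m" "m \<le> l"
  shows "lame_residue l E K \<zeta> (lame_coeffs l E K) m = 0"
proof -
  let ?A = "\<lambda>j. poly (lame_poly \<tau> \<eta> l j) E"
  obtain n where n: "m = Suc n" "1 \<le> n" using assms by (cases m) auto
  define k where "k = - inverse K"
  have Kk: "K * k = - 1" "inverse K = - k" using assms by (simp_all add: k_def)
  have b: "eb l (Suc n) * en (int m) = eb l n * en (int l - int n)"
    using ell_binom_Suc[of n l] n assms by simp
  have t1: "lame_coeffs l E K (m + 1) = k ^ Suc m * eb l m * en (int l - int m) * ?A (m + 1)"
    using lame_coeffs_Suc[OF assms(3)] by (simp add: k_def)
  have t2: "lame_coeffs l E K m = k ^ m * en (int m) * eb l m * ?A m"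
    using assms by (simp add: lame_coeffs_def k_def)
  have t3: "lame_coeffs l E K (m - 1) = k ^ n * en (int n) * eb l n * ?A n"
    using assms n by (simp add: lame_coeffs_def k_def)
  have rec: "en (int m + int l) * ?A n = E * en (int m) * ?A m + en (int l - int m) * ?A (m + 1)"
    using lame_poly_recurrence[of m l E] assms n(1) by (simp add: add.commute)
  have ints: "int m - 1 = int n" "int m - int l - 1 = - (int l - int n)" using n by auto
  have nz: "en (int m) \<noteq> 0" "en (int n) \<noteq> 0" using n by auto
  have "en (int m + int l) * en (int m - int l - 1) / (en (int m) * en (int m - 1)) * lame_coeffs l E K (m - 1)
      = - en (int m + int l) * (eb l n * en (int l - int n)) * k ^ n * ?A n / en (int m)"
    unfolding ints ell_num_minus t3 using nz by (simp add: field_simps del: ell_num_eq_0_iff)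
  also have "\<dots> = - (k ^ n * eb l m) * (en (int m + int l) * ?A n)"
    unfolding b[symmetric] using nz n(1) by (simp add: field_simps del: ell_num_eq_0_iff)
  finally have q: "en (int m + int l) * en (int m - int l - 1) / (en (int m) * en (int m - 1)) * lame_coeffs l E K (m - 1)
      = - (k ^ n * eb l m) * (en (int m + int l) * ?A n)" .
  have t3': "inverse K * (en (int m + int l) * en (int m - int l - 1) / (en (int m) * en (int m - 1))) * lame_coeffs l E K (m - 1)
      = k ^ m * eb l m * (en (int m + int l) * ?A n)"
  proof -
    have "inverse K * (- (k ^ n * eb l m) * (en (int m + int l) * ?A n))
        = k ^ m * eb l m * (en (int m + int l) * ?A n)"
      unfolding Kk(2) by (simp add: n(1))
    then show ?thesis by (subst mult.assoc) (simp only: q)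
  qed
  have t1': "K * lame_coeffs l E K (m + 1) = - (k ^ m * eb l m * (en (int l - int m) * ?A (m + 1)))"
  proof -
    have "K * lame_coeffs l E K (m + 1) = (K * k) * (k ^ m * eb l m * (en (int l - int m) * ?A (m + 1)))"
      unfolding t1 by simp
    then show ?thesis unfolding Kk by simp
  qed
  show ?thesis
    unfolding lame_residue_def t1' t3' t2 rec using assms by (simp add: algebra_simps)
qed

text \<open>The source of the factors theta1(\<zeta> - j\<eta>) in the two equations.\<close>

lemma Phi_neg_multiple:
  "Phi \<tau> (- of_nat j * \<eta>) \<zeta> = - \<theta> (\<zeta> - of_nat j * \<eta>) / (\<theta> \<eta> * en (int j) * \<theta> \<zeta>)"
  using theta1_minus[of \<tau> "of_nat j * \<eta>"] theta_eq_ell_num[of "int j"]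
  by (simp add: Phi_def)

lemma lame_residue_0_coeffs:
  assumes "K \<noteq> 0" "1 \<le> l" "\<theta> \<zeta> \<noteq> 0"
  shows "\<theta> \<zeta> * lame_residue l E K \<zeta> (lame_coeffs l E K) 0
    = en (int l) * (\<Sum>j=0..l+1. (-1) ^ j * K powi (- int j) * \<theta> (\<zeta> - of_nat j * \<eta>)
        * en (int j - 1) * eb (l + 1) j * poly (lame_poly \<tau> \<eta> l (nat \<bar>int j - 1\<bar>)) E)"
    (is "_ = _ * sum ?f _")
proof -
  let ?A = "\<lambda>j. poly (lame_poly \<tau> \<eta> l j) E" and ?t = "lame_coeffs l E K"
  define k where "k = - inverse K"
  have Kk: "K * k = - 1" "inverse K = - k" using assms by (simp_all add: k_def)
  have pk: "(-1) ^ j * K powi (- int j) = k ^ j" for j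
    by (simp add: k_def power_int_minus power_minus' power_inverse flip: power_mult_distrib)
  have "sum ?f {0..l+1} = ?f 0 + (?f 1 + (\<Sum>j=1..l. ?f (Suc j)))"
    by (rule sum_split_first_two)
  \<comment> \<open>At j = 0 the factor is [-1] = -1 and the index |j-1| is 1: this is the
    contribution of K s_1. The term j = 1 vanishes through [0], and the terms j+1 \<ge> 2 come from
    Phi(-(j+1)\<eta>, \<zeta>).\<close>
  also have "?f 0 = - (\<theta> \<zeta> * ?A 1)"
    using ell_num_minus[of 1] by simp
  also have "?f 1 = 0" by simp
  also have "(\<Sum>j=1..l. ?f (Suc j))
      = (\<Sum>j=1..l. k * en (int l + 1) * (?t j * \<theta> (\<zeta> - of_nat (j + 1) * \<eta>) / en (int (j + 1))))"
  proof (rule sum.cong[OF refl])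
    fix j assume "j \<in> {1..l}"
    then have t: "?t j = k ^ j * en (int j) * eb l j * ?A j" by (simp add: lame_coeffs_def k_def)
    have nz: "en (int (Suc j)) \<noteq> 0" by simp
    have b: "eb (l + 1) (Suc j) = en (int l + 1) * eb l j / en (int (Suc j))"
      using ell_binom_Suc_Suc[of l j] nz by (simp add: nonzero_eq_divide_eq add.commute del: ell_num_eq_0_iff)
    show "?f (Suc j) = k * en (int l + 1) * (?t j * \<theta> (\<zeta> - of_nat (j + 1) * \<eta>) / en (int (j + 1)))"
      unfolding pk b t by (simp add: mult_ac)
  qed
  finally have sum: "sum ?f {0..l+1} = - (\<theta> \<zeta> * ?A 1)
      + k * en (int l + 1) * (\<Sum>j=1..l. ?t j * \<theta> (\<zeta> - of_nat (j + 1) * \<eta>) / en (int (j + 1)))"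
    by (simp add: sum_distrib_left)
  have P: "(\<Sum>j=1..l. ?t j * Phi \<tau> (- of_nat (j + 1) * \<eta>) \<zeta>)
      = - inverse (\<theta> \<eta> * \<theta> \<zeta>) * (\<Sum>j=1..l. ?t j * \<theta> (\<zeta> - of_nat (j + 1) * \<eta>) / en (int (j + 1)))"
    unfolding sum_distrib_left Phi_neg_multiple
    by (intro sum.cong refl) (simp add: divide_inverse mult_ac)
  have t1: "K * ?t 1 = - en (int l) * ?A 1"
  proof -
    have "?t (Suc 0) = k * en (int l) * ?A (Suc 0)"
      using lame_coeffs_Suc[of 0 l E K] by (simp add: k_def)
    then have "K * ?t 1 = (K * k) * (en (int l) * ?A 1)" by simp
    then show ?thesis unfolding Kk by simp
  qed
  have "\<theta> \<zeta> * lame_residue l E K \<zeta> ?t 0 = \<theta> \<zeta> * (K * ?t 1)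
      + \<theta> \<zeta> * (inverse K * (\<theta> \<eta> * en (int l) * en (int l + 1)) * (\<Sum>j=1..l. ?t j * Phi \<tau> (- of_nat (j + 1) * \<eta>) \<zeta>))"
    by (simp add: lame_residue_def lame_coeffs_def distrib_left)
  also have "\<dots> = en (int l) * sum ?f {0..l+1}"
    unfolding sum t1 P Kk(2) using assms(3) theta_eta_nonzero by (simp add: field_simps)
  finally show ?thesis .
qed

lemma lame_residue_1_coeffs:
  assumes "K \<noteq> 0" "1 \<le> l" "\<theta> \<zeta> \<noteq> 0"
  shows "\<theta> \<zeta> * lame_residue l E K \<zeta> (lame_coeffs l E K) 1
    = inverse K * en (int l) * en (int l + 1) * (\<Sum>j=0..l. (-1) ^ j * K powi (- int j) * \<theta> (\<zeta> - of_nat j * \<eta>)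
        * eb l j * poly (lame_poly \<tau> \<eta> l j) E)"
    (is "_ = _ * sum ?f _")
proof -
  let ?A = "\<lambda>j. poly (lame_poly \<tau> \<eta> l j) E" and ?t = "lame_coeffs l E K"
  define k where "k = - inverse K"
  have Kk: "K * k = - 1" "inverse K = - k" using assms by (simp_all add: k_def)
  have pk: "(-1) ^ j * K powi (- int j) = k ^ j" for j
    by (simp add: k_def power_int_minus power_minus' power_inverse flip: power_mult_distrib)
  have "sum ?f {0..l} = ?f 0 + (\<Sum>j=1..l. ?f j)"
    by (simp add: sum.atLeast_Suc_atMost)
  also have "?f 0 = \<theta> \<zeta> * ?A 0" by simp
  also have "(\<Sum>j=1..l. ?f j) = (\<Sum>j=1..l. ?t j * \<theta> (\<zeta> - of_nat j * \<eta>) / en (int j))"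
  proof (rule sum.cong[OF refl])
    fix j assume j: "j \<in> {1..l}"
    then have t: "?t j = k ^ j * en (int j) * eb l j * ?A j" by (simp add: lame_coeffs_def k_def)
    have "en (int j) \<noteq> 0" using j by simp
    then show "?f j = ?t j * \<theta> (\<zeta> - of_nat j * \<eta>) / en (int j)"
      unfolding pk t by (simp add: field_simps del: ell_num_eq_0_iff)
  qed
  finally have sum: "sum ?f {0..l} = \<theta> \<zeta> * ?A 0 + (\<Sum>j=1..l. ?t j * \<theta> (\<zeta> - of_nat j * \<eta>) / en (int j))" .
  have P: "(\<Sum>j=1..l. ?t j * Phi \<tau> (- of_nat j * \<eta>) \<zeta>)
      = - inverse (\<theta> \<eta> * \<theta> \<zeta>) * (\<Sum>j=1..l. ?t j * \<theta> (\<zeta> - of_nat j * \<eta>) / en (int j))"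
    unfolding sum_distrib_left Phi_neg_multiple
    by (intro sum.cong refl) (simp add: divide_inverse mult_ac)
  have t1: "?t 1 = k * en (int l) * ?A 1"
    using lame_coeffs_Suc[of 0 l E K] by (simp add: k_def)
  have t2: "?t (1 + 1) = k * k * en (int l) * en (int l - 1) * ?A (1 + 1)"
  proof -
    have "eb l 1 = en (int l)" using ell_binom_Suc[of 0 l] assms by simp
    then show ?thesis using lame_coeffs_Suc[of 1 l E K] assms by (simp add: k_def)
  qed
  \<comment> \<open>The recurrence at m = 1 replaces E A_1 + [l-1] A_2 by [l+1] A_0, which supplies
    the j = 0 term of the first equation.\<close>
  have t12: "K * ?t (1 + 1) - E * ?t 1 = - k * en (int l) * (en (int l + 1) * ?A 0)"
  proof -
    have "K * ?t (1 + 1) = (K * k) * (k * en (int l) * en (int l - 1) * ?A (1 + 1))"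
      unfolding t2 by simp
    then have "K * ?t (1 + 1) = - (k * en (int l) * en (int l - 1) * ?A (1 + 1))"
      unfolding Kk by simp
    moreover have "en (int l + 1) * ?A 0 = E * ?A 1 + en (int l - 1) * ?A (1 + 1)"
      using lame_poly_recurrence[of 1 l E] assms by simp
    ultimately show ?thesis unfolding t1 by (simp add: algebra_simps)
  qed
  have "\<theta> \<zeta> * lame_residue l E K \<zeta> ?t 1 = \<theta> \<zeta> * (K * ?t (1 + 1) - E * ?t 1)
      - \<theta> \<zeta> * (inverse K * (\<theta> \<eta> * en (int l) * en (int l + 1)) * (\<Sum>j=1..l. ?t j * Phi \<tau> (- of_nat j * \<eta>) \<zeta>))"
    by (simp add: lame_residue_def lame_coeffs_def right_diff_distrib)
  also have "\<dots> = inverse K * en (int l) * en (int l + 1) * sum ?f {0..l}"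
    unfolding sum t12 P Kk(2) using assms(3) theta_eta_nonzero by (simp add: field_simps)
  finally show ?thesis .
qed

section \<open>The equation as a set of residue conditions\<close>

lemma eventually_in_lame_domain: "\<forall>\<^sub>F x in at z. x \<in> lame_domain \<tau> \<eta> l"
  unfolding lame_domain_def mem_Collect_eq
  using eventually_add_not_in_period_lattice[OF Im_tau, of "- (of_nat _ * \<eta>)" z]
  by (intro eventually_ball_finite) auto

lemma of_nat_diff_eta_not_in_period_lattice:
  assumes "i \<noteq> j"
  shows "of_nat i * \<eta> - of_nat j * \<eta> \<notin> period_lattice \<tau>"
  using generic[of "int i - int j"] assms by (simp add: left_diff_distrib)

lemma eta_nonzero: "\<eta> \<noteq> 0"
  using generic[of 1] period_lattice_0 by auto

lemma Phi_sum_eq_0_imp: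
  assumes "\<zeta> \<notin> period_lattice \<tau>" "finite J" "i \<in> J"
    and "\<And>x. x \<in> lame_domain \<tau> \<eta> l \<Longrightarrow> (\<Sum>j\<in>J. r j * Phi \<tau> (x - of_nat j * \<eta>) \<zeta>) = 0"
  shows "r i = 0"
proof (rule Phi_linearly_independent[OF Im_tau assms(1-3), where p = "\<lambda>j. of_nat j * \<eta>"])
  show "\<forall>\<^sub>F x in at (of_nat i * \<eta>). (\<Sum>j\<in>J. r j * Phi \<tau> (x - of_nat j * \<eta>) \<zeta>) = 0"
    using eventually_in_lame_domain by (rule eventually_mono) (rule assms(4))
qed (simp add: of_nat_diff_eta_not_in_period_lattice)

lemma Phi_add_1: "Phi \<tau> (x + 1) \<zeta> = Phi \<tau> x \<zeta>"
  using theta1_add_1[of \<tau> x] theta1_add_1[of \<tau> "\<zeta> + x"] by (simp add: Phi_def add.assoc)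

text \<open>The theta multipliers of numerator and denominator differ by exp(-2\<pi>i\<zeta>). At
  poles both sides are 0, since the lattice is invariant under the shift.\<close>

lemma Phi_add_tau: "Phi \<tau> (x + \<tau>) \<zeta> = exp (- 2 * of_real pi * \<i> * \<zeta>) * Phi \<tau> x \<zeta>"
proof -
  define m where "m y = exp (- of_real pi * \<i> * \<tau> - 2 * of_real pi * \<i> * y)" for y
  have m: "m (\<zeta> + x) = exp (- 2 * of_real pi * \<i> * \<zeta>) * m x"
    unfolding m_def exp_add[symmetric] by (simp add: algebra_simps)
  have "m x \<noteq> 0" by (simp add: m_def)
  moreover have "\<theta> (\<zeta> + (x + \<tau>)) = - m (\<zeta> + x) * \<theta> (\<zeta> + x)" "\<theta> (x + \<tau>) = - m x * \<theta> x"
    using theta1_add_tau[of \<tau> "\<zeta> + x"] theta1_add_tau[of \<tau> x] by (simp_all only: m_def add.assoc)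
  ultimately show ?thesis by (simp add: Phi_def m)
qed

lemma double_bloch_bloch_ansatz: "double_bloch \<tau> (bloch_ansatz \<tau> \<eta> l L \<zeta> s)"
  unfolding double_bloch_def
proof (intro exI allI conjI)
  fix x
  have 1: "Phi \<tau> (x + 1 - of_nat j * \<eta>) \<zeta> = Phi \<tau> (x - of_nat j * \<eta>) \<zeta>" for j
    using Phi_add_1[of "x - of_nat j * \<eta>"] by (simp add: algebra_simps)
  show "bloch_ansatz \<tau> \<eta> l L \<zeta> s (x + 1) = exp (1 / \<eta> * L) * bloch_ansatz \<tau> \<eta> l L \<zeta> s x"
    unfolding bloch_ansatz_def 1 by (simp add: add_divide_distrib distrib_right exp_add)
  have 2: "Phi \<tau> (x + \<tau> - of_nat j * \<eta>) \<zeta> = exp (- 2 * of_real pi * \<i> * \<zeta>) * Phi \<tau> (x - of_nat j * \<eta>) \<zeta>" for j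
    using Phi_add_tau[of "x - of_nat j * \<eta>"] by (simp add: algebra_simps)
  have e: "exp ((x + \<tau>) / \<eta> * L) = exp (\<tau> / \<eta> * L) * exp (x / \<eta> * L)"
    by (simp add: add_divide_distrib distrib_right exp_add)
  show "bloch_ansatz \<tau> \<eta> l L \<zeta> s (x + \<tau>)
      = (exp (\<tau> / \<eta> * L) * exp (- 2 * of_real pi * \<i> * \<zeta>)) * bloch_ansatz \<tau> \<eta> l L \<zeta> s x"
    unfolding bloch_ansatz_def 2 e by (simp add: sum_distrib_left mult_ac)
qed

text \<open>Partial fractions with zeros -l\<eta>, (l+1)\<eta> and poles 0, \<eta>, (j+1)\<eta>. The
  poles are incongruent because j+1 \<ge> 2, and all differences are integer multiples of \<eta>, so
  the coefficients become elliptic numbers.\<close>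

lemma lame_coefficient_Phi:
  assumes "\<zeta> \<notin> period_lattice \<tau>" and x: "x \<in> lame_domain \<tau> \<eta> l" and j: "1 \<le> j" "j \<le> l"
  shows "\<theta> (x + of_nat l * \<eta>) * \<theta> (x - of_nat (l + 1) * \<eta>) / (\<theta> x * \<theta> (x - \<eta>)) * Phi \<tau> (x - of_nat (j + 1) * \<eta>) \<zeta>
    = \<theta> \<eta> * en (int l) * en (int l + 1) * Phi \<tau> (- of_nat (j + 1) * \<eta>) \<zeta> * Phi \<tau> x \<zeta>
    - \<theta> \<eta> * en (int l) * en (int l + 1) * Phi \<tau> (- of_nat j * \<eta>) \<zeta> * Phi \<tau> (x - \<eta>) \<zeta>
    + en (int (j + 1) + int l) * en (int (j + 1) - int l - 1) / (en (int (j + 1)) * en (int (j + 1) - 1))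
        * Phi \<tau> (x - of_nat (j + 1) * \<eta>) \<zeta>"
proof -
  define u where "u = - (of_nat l * \<eta>)"
  define v where "v = of_nat (l + 1) * \<eta>"
  define c where "c = of_nat (j + 1) * \<eta>"
  have th: "\<theta> y = \<theta> \<eta> * en i" if "y = of_int i * \<eta>" for y i
    unfolding that by (rule theta_eq_ell_num)
  have dom: "x - of_nat i * \<eta> \<notin> period_lattice \<tau>" if "i \<le> l + 1" for i
    using x that by (simp add: lame_domain_def)
  have d: "\<eta> - 0 \<notin> period_lattice \<tau>" "c - 0 \<notin> period_lattice \<tau>" "c - \<eta> \<notin> period_lattice \<tau>"
    using of_nat_diff_eta_not_in_period_lattice[of 1 0] of_nat_diff_eta_not_in_period_lattice[of "j + 1" 0]
      of_nat_diff_eta_not_in_period_lattice[of "j + 1" 1] j by (simp_all add: c_def)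
  have dx: "x - 0 \<notin> period_lattice \<tau>" "x - \<eta> \<notin> period_lattice \<tau>" "x - c \<notin> period_lattice \<tau>"
    using dom[of 0] dom[of 1] dom[of "j + 1"] j by (simp_all add: c_def)
  have uv: "u + v = 0 + \<eta>" by (simp add: u_def v_def algebra_simps)
  have t: "\<theta> (0 - u) = \<theta> \<eta> * en (int l)" "\<theta> (0 - v) = \<theta> \<eta> * en (- (int l + 1))" "\<theta> (0 - \<eta>) = \<theta> \<eta> * en (- 1)"
    "\<theta> (\<eta> - u) = \<theta> \<eta> * en (int l + 1)" "\<theta> (\<eta> - v) = \<theta> \<eta> * en (- int l)" "\<theta> (\<eta> - 0) = \<theta> \<eta> * en 1"
    "\<theta> (c - u) = \<theta> \<eta> * en (int (j + 1) + int l)" "\<theta> (c - v) = \<theta> \<eta> * en (int (j + 1) - int l - 1)"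
    "\<theta> (c - 0) = \<theta> \<eta> * en (int (j + 1))" "\<theta> (c - \<eta>) = \<theta> \<eta> * en (int (j + 1) - 1)"
    by (rule th, simp add: u_def v_def c_def algebra_simps)+
  have args: "x - u = x + of_nat l * \<eta>" "x - 0 = x" "0 - c = - of_nat (j + 1) * \<eta>" "\<eta> - c = - of_nat j * \<eta>"
    by (simp_all add: u_def c_def algebra_simps)
  have nz: "\<theta> \<eta> \<noteq> 0" by (rule theta_eta_nonzero)
  have "\<theta> (x - u) * \<theta> (x - v) / (\<theta> (x - 0) * \<theta> (x - \<eta>)) * Phi \<tau> (x - c) \<zeta>
    = \<theta> (0 - u) * \<theta> (0 - v) / \<theta> (0 - \<eta>) * Phi \<tau> (0 - c) \<zeta> * Phi \<tau> (x - 0) \<zeta>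
    + \<theta> (\<eta> - u) * \<theta> (\<eta> - v) / \<theta> (\<eta> - 0) * Phi \<tau> (\<eta> - c) \<zeta> * Phi \<tau> (x - \<eta>) \<zeta>
    + \<theta> (c - u) * \<theta> (c - v) / (\<theta> (c - 0) * \<theta> (c - \<eta>)) * Phi \<tau> (x - c) \<zeta>"
    by (rule Phi_partial_fraction[OF Im_tau assms(1) uv d dx])
  also have "\<theta> (0 - u) * \<theta> (0 - v) / \<theta> (0 - \<eta>) = \<theta> \<eta> * en (int l) * en (int l + 1)"
    unfolding t ell_num_minus using nz by simp
  also have "\<theta> (\<eta> - u) * \<theta> (\<eta> - v) / \<theta> (\<eta> - 0) = - (\<theta> \<eta> * en (int l) * en (int l + 1))"
    unfolding t ell_num_minus using nz by simp
  also have "\<theta> (c - u) * \<theta> (c - v) / (\<theta> (c - 0) * \<theta> (c - \<eta>))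
      = en (int (j + 1) + int l) * en (int (j + 1) - int l - 1) / (en (int (j + 1)) * en (int (j + 1) - 1))"
    unfolding t using nz by simp
  finally show ?thesis
    unfolding args v_def[symmetric] c_def[symmetric] by simp
qed

lemma lame_equation_residue_expansion:
  assumes "\<zeta> \<notin> period_lattice \<tau>" and x: "x \<in> lame_domain \<tau> \<eta> l" and "1 \<le> l"
    and s0: "s 0 = 0" "s (Suc l) = 0"
  shows "K * (\<Sum>j=1..l. s j * Phi \<tau> (x + \<eta> - of_nat j * \<eta>) \<zeta>)
    + \<theta> (x + of_nat l * \<eta>) * \<theta> (x - of_nat (l + 1) * \<eta>) / (\<theta> x * \<theta> (x - \<eta>))
        * (inverse K * (\<Sum>j=1..l. s j * Phi \<tau> (x - \<eta> - of_nat j * \<eta>) \<zeta>))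
    - E * (\<Sum>j=1..l. s j * Phi \<tau> (x - of_nat j * \<eta>) \<zeta>)
    = (\<Sum>m=0..l. lame_residue l E K \<zeta> s m * Phi \<tau> (x - of_nat m * \<eta>) \<zeta>)"
proof -
  define F where "F m = Phi \<tau> (x - of_nat m * \<eta>) \<zeta>" for m :: nat
  define \<gamma> where "\<gamma> m = en (int m + int l) * en (int m - int l - 1) / (en (int m) * en (int m - 1))" for m :: nat
  define C where "C = \<theta> (x + of_nat l * \<eta>) * \<theta> (x - of_nat (l + 1) * \<eta>) / (\<theta> x * \<theta> (x - \<eta>))"
  define a where "a = \<theta> \<eta> * en (int l) * en (int l + 1)"
  define p where "p = (\<Sum>j=1..l. s j * Phi \<tau> (- of_nat (j + 1) * \<eta>) \<zeta>)"
  define q where "q = (\<Sum>j=1..l. s j * Phi \<tau> (- of_nat j * \<eta>) \<zeta>)"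
  have S1: "(\<Sum>j=1..l. s j * Phi \<tau> (x + \<eta> - of_nat j * \<eta>) \<zeta>) = (\<Sum>m=0..l. s (m + 1) * F m)"
  proof -
    have "(\<Sum>m=0..l. s (m + 1) * F m) = (\<Sum>m=0..l. s (Suc m) * Phi \<tau> (x + \<eta> - of_nat (Suc m) * \<eta>) \<zeta>)"
      by (simp add: F_def algebra_simps)
    also have "\<dots> = (\<Sum>j=Suc 0..Suc l. s j * Phi \<tau> (x + \<eta> - of_nat j * \<eta>) \<zeta>)"
      by (rule sum.shift_bounds_cl_Suc_ivl[symmetric])
    finally show ?thesis using s0 by simp
  qed
  have S3: "(\<Sum>j=1..l. s j * Phi \<tau> (x - of_nat j * \<eta>) \<zeta>) = (\<Sum>m=0..l. s m * F m)"
    using s0 by (simp add: F_def sum.atLeast_Suc_atMost)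
  define g where "g m = \<gamma> m * s (m - 1) * F m" for m
  \<comment> \<open>At m = 0 and m = 1 the denominator contains [0], and division by zero gives 0.
    At m = l+1 the numerator contains [0], which is why the expansion ends at l.\<close>
  have g: "g 0 = 0" "g 1 = 0" "g (Suc l) = 0"
    using s0 by (simp_all add: g_def \<gamma>_def)
  have "C * (\<Sum>j=1..l. s j * Phi \<tau> (x - \<eta> - of_nat j * \<eta>) \<zeta>)
      = (\<Sum>j=1..l. a * (s j * Phi \<tau> (- of_nat (j + 1) * \<eta>) \<zeta>) * F 0 - a * (s j * Phi \<tau> (- of_nat j * \<eta>) \<zeta>) * F 1
          + g (Suc j))"
    unfolding sum_distrib_left
  proof (rule sum.cong[OF refl])
    fix j assume "j \<in> {1..l}"
    then have j: "1 \<le> j" "j \<le> l" by auto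
    have arg: "x - \<eta> - of_nat j * \<eta> = x - of_nat (j + 1) * \<eta>" by (simp add: algebra_simps)
    have "C * Phi \<tau> (x - \<eta> - of_nat j * \<eta>) \<zeta> = a * Phi \<tau> (- of_nat (j + 1) * \<eta>) \<zeta> * F 0
        - a * Phi \<tau> (- of_nat j * \<eta>) \<zeta> * F 1 + \<gamma> (j + 1) * F (j + 1)"
      unfolding arg C_def lame_coefficient_Phi[OF assms(1) x j] by (simp add: a_def \<gamma>_def F_def)
    then have "s j * (C * Phi \<tau> (x - \<eta> - of_nat j * \<eta>) \<zeta>) = s j * (a * Phi \<tau> (- of_nat (j + 1) * \<eta>) \<zeta> * F 0
        - a * Phi \<tau> (- of_nat j * \<eta>) \<zeta> * F 1 + \<gamma> (j + 1) * F (j + 1))" by simp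
    then show "C * (s j * Phi \<tau> (x - \<eta> - of_nat j * \<eta>) \<zeta>) = a * (s j * Phi \<tau> (- of_nat (j + 1) * \<eta>) \<zeta>) * F 0
        - a * (s j * Phi \<tau> (- of_nat j * \<eta>) \<zeta>) * F 1 + g (Suc j)"
      by (simp add: g_def algebra_simps)
  qed
  also have "\<dots> = a * p * F 0 - a * q * F 1 + (\<Sum>j=1..l. g (Suc j))"
    by (simp add: p_def q_def sum.distrib sum_subtractf sum_distrib_left sum_distrib_right)
  also have "(\<Sum>j=1..l. g (Suc j)) = sum g {0..l+1}"
    using g sum_split_first_two[of g l] by simp
  also have "\<dots> = sum g {0..l}" using g by simp
  finally have S2: "C * (\<Sum>j=1..l. s j * Phi \<tau> (x - \<eta> - of_nat j * \<eta>) \<zeta>) = a * p * F 0 - a * q * F 1 + sum g {0..l}" .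
  have "lame_residue l E K \<zeta> s m * F m = K * (s (m + 1) * F m) - E * (s m * F m) + inverse K * g m
      + (if m = 0 then inverse K * (a * p) * F 0 else 0) - (if m = 1 then inverse K * (a * q) * F 1 else 0)" for m
    unfolding lame_residue_def a_def[symmetric] p_def[symmetric] q_def[symmetric] \<gamma>_def[symmetric] g_def
    by (simp add: algebra_simps)
  then have "(\<Sum>m=0..l. lame_residue l E K \<zeta> s m * F m)
      = K * (\<Sum>m=0..l. s (m + 1) * F m) - E * (\<Sum>m=0..l. s m * F m) + inverse K * sum g {0..l}
      + inverse K * (a * p) * F 0 - inverse K * (a * q) * F 1"
    using assms(3) by (simp add: sum.distrib sum_subtractf sum_distrib_left)
  also have "\<dots> = K * (\<Sum>m=0..l. s (m + 1) * F m) - E * (\<Sum>m=0..l. s m * F m)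
      + inverse K * (a * p * F 0 - a * q * F 1 + sum g {0..l})"
    by (simp add: algebra_simps)
  finally show ?thesis
    unfolding S1 S3 unfolding C_def[symmetric] F_def[symmetric] S2[symmetric] by (simp add: mult_ac)
qed

lemma lame_equation_iff_residues:
  assumes "\<zeta> \<notin> period_lattice \<tau>" "1 \<le> l" "exp L = K"
    and s0: "s 0 = 0" "s (Suc l) = 0"
  shows "(\<forall>x\<in>lame_domain \<tau> \<eta> l. lame_equation \<tau> \<eta> l E (bloch_ansatz \<tau> \<eta> l L \<zeta> s) x)
    \<longleftrightarrow> (\<forall>m\<le>l. lame_residue l E K \<zeta> s m = 0)"
proof -
  let ?R = "\<lambda>x. \<Sum>m=0..l. lame_residue l E K \<zeta> s m * Phi \<tau> (x - of_nat m * \<eta>) \<zeta>"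
  have eq: "lame_equation \<tau> \<eta> l E (bloch_ansatz \<tau> \<eta> l L \<zeta> s) x \<longleftrightarrow> ?R x = 0" if "x \<in> lame_domain \<tau> \<eta> l" for x
  proof -
    define e where "e = exp (x / \<eta> * L)"
    define C where "C = \<theta> (x + of_nat l * \<eta>) * \<theta> (x - of_nat (l + 1) * \<eta>) / (\<theta> x * \<theta> (x - \<eta>))"
    define P1 where "P1 = (\<Sum>j=1..l. s j * Phi \<tau> (x + \<eta> - of_nat j * \<eta>) \<zeta>)"
    define P2 where "P2 = (\<Sum>j=1..l. s j * Phi \<tau> (x - \<eta> - of_nat j * \<eta>) \<zeta>)"
    define P3 where "P3 = (\<Sum>j=1..l. s j * Phi \<tau> (x - of_nat j * \<eta>) \<zeta>)"
    \<comment> \<open>Shifting x by \<eta> changes the exponent by L, so the chosen logarithm enters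
      only through exp L = K.\<close>
    have "(x + \<eta>) / \<eta> * L = x / \<eta> * L + L" "(x - \<eta>) / \<eta> * L = x / \<eta> * L + - L"
      using eta_nonzero by (simp_all add: field_simps)
    then have "exp ((x + \<eta>) / \<eta> * L) = e * K" "exp ((x - \<eta>) / \<eta> * L) = e * inverse K"
      using assms(3) by (simp_all only: exp_add exp_minus e_def)
    then have b: "bloch_ansatz \<tau> \<eta> l L \<zeta> s (x + \<eta>) = e * K * P1" "bloch_ansatz \<tau> \<eta> l L \<zeta> s (x - \<eta>) = e * inverse K * P2"
      "bloch_ansatz \<tau> \<eta> l L \<zeta> s x = e * P3"
      by (simp_all only: bloch_ansatz_def P1_def P2_def P3_def e_def)
    have "lame_equation \<tau> \<eta> l E (bloch_ansatz \<tau> \<eta> l L \<zeta> s) x \<longleftrightarrow> e * K * P1 + C * (e * inverse K * P2) = E * (e * P3)"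
      unfolding lame_equation_def b C_def ..
    also have "\<dots> \<longleftrightarrow> e * (K * P1 + C * (inverse K * P2) - E * P3) = 0"
      by (simp add: algebra_simps del: mult_eq_0_iff)
    also have "K * P1 + C * (inverse K * P2) - E * P3 = ?R x"
      unfolding C_def P1_def P2_def P3_def
      by (rule lame_equation_residue_expansion[OF assms(1) that assms(2) s0])
    finally show ?thesis by (simp add: e_def)
  qed
  show ?thesis
  proof
    assume *: "\<forall>x\<in>lame_domain \<tau> \<eta> l. lame_equation \<tau> \<eta> l E (bloch_ansatz \<tau> \<eta> l L \<zeta> s) x"
    show "\<forall>m\<le>l. lame_residue l E K \<zeta> s m = 0"
    proof (intro allI impI)
      fix m assume "m \<le> l"
      show "lame_residue l E K \<zeta> s m = 0"
        by (rule Phi_sum_eq_0_imp[OF assms(1), where J = "{0..l}" and l = l]) (use \<open>m \<le> l\<close> * eq in auto)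
    qed
  qed (simp add: eq)
qed

text \<open>The factor of s(m-1) is a quotient of elliptic numbers with nonzero arguments, hence
  nonzero by genericity: the downward step of the recurrence.\<close>

lemma lame_residue_eq_0_imp_prev_eq_0:
  assumes "K \<noteq> 0" "2 \<le> m" "m \<le> l" "lame_residue l E K \<zeta> s m = 0" "s m = 0" "s (Suc m) = 0"
  shows "s (m - 1) = 0"
proof -
  have "en (int m + int l) \<noteq> 0" "en (int m - int l - 1) \<noteq> 0" "en (int m) \<noteq> 0" "en (int m - 1) \<noteq> 0"
    using assms by simp_all
  then show ?thesis using assms by (simp add: lame_residue_def del: ell_num_eq_0_iff)
qed

text \<open>Linearity in the coefficients, in the one form that serves both to compare two solutions
  and, with s = 0, to scale one.\<close>

lemma lame_residue_diff_scale:
  "lame_residue l E K \<zeta> (\<lambda>j. s j - c * t j) m = lame_residue l E K \<zeta> s m - c * lame_residue l E K \<zeta> t m"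
proof -
  have lin: "(\<Sum>j=1..l. (s j - c * t j) * f j) = (\<Sum>j=1..l. s j * f j) - c * (\<Sum>j=1..l. t j * f j)" for f :: "nat \<Rightarrow> complex"
    by (simp add: left_diff_distrib sum_subtractf sum_distrib_left mult.assoc)
  show ?thesis
    unfolding lame_residue_def lin by (simp add: algebra_simps diff_divide_distrib)
qed

lemma lame_coeffs_top_nonzero:
  assumes "K \<noteq> 0" "1 \<le> l"
  shows "lame_coeffs l E K l \<noteq> 0"
  using assms by (simp add: lame_coeffs_def lame_poly_self)

text \<open>The residue conditions at \<open>2 \<eta>, \<dots>, l \<eta>\<close> form a three-term recurrence that determines all
  coefficients from the last one.\<close>

lemma solution_proportional_to_lame_coeffs:
  assumes "K \<noteq> 0" "1 \<le> l" and s0: "s 0 = 0" "\<And>j. j > l \<Longrightarrow> s j = 0"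
    and res: "\<And>m. 2 \<le> m \<Longrightarrow> m \<le> l \<Longrightarrow> lame_residue l E K \<zeta> s m = 0"
  shows "s j = s l / lame_coeffs l E K l * lame_coeffs l E K j"
proof -
  \<comment> \<open>The scalar matching the two sequences at index l, so that their difference
    vanishes from l upwards.\<close>
  define c where "c = s l / lame_coeffs l E K l"
  define d where "d j = s j - c * lame_coeffs l E K j" for j
  have d_res: "lame_residue l E K \<zeta> d m = 0" if "2 \<le> m" "m \<le> l" for m
    unfolding d_def lame_residue_diff_scale using res[OF that] lame_residue_coeffs[OF assms(1) that] by simp
  have d_top: "d j = 0" if "j \<ge> l" for j
    using that s0(2)[of j] lame_coeffs_top_nonzero[OF assms(1,2)]
    by (cases "j = l") (simp_all add: d_def c_def lame_coeffs_def)
  have d0: "d 0 = 0" by (simp add: d_def s0(1) lame_coeffs_def)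
  \<comment> \<open>Two consecutive zeros are carried along because the recurrence has three terms.
    It stops at index 1; the value at 0 vanishes by the boundary condition.\<close>
  have "d (l - i) = 0 \<and> d (Suc (l - i)) = 0" for i
  proof (induction i)
    case (Suc i)
    consider "l \<le> Suc i" | "Suc i < l" by linarith
    then show ?case
    proof cases
      case 1
      then have "l - Suc i = 0" by simp
      moreover have "l - i = 0 \<or> l - i = 1" using 1 by auto
      then have "d (Suc 0) = 0" using Suc by auto
      ultimately show ?thesis using d0 by simp
    next
      case 2
      then have "2 \<le> l - i" "l - i \<le> l" by auto
      from lame_residue_eq_0_imp_prev_eq_0[OF assms(1) this d_res[OF this]] Suc
      have "d (l - i - 1) = 0" by simp
      moreover have "l - i - 1 = l - Suc i" "Suc (l - Suc i) = l - i" using 2 by auto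
      ultimately show ?thesis using Suc by simp
    qed
  qed (use d_top in simp)
  from this[of "l - j"] have "d j = 0" using d_top[of j] by (cases "j \<le> l") auto
  then show ?thesis by (simp add: d_def c_def)
qed

end

theorem theorem3p1:
  fixes l :: nat and \<tau> \<eta> E K L \<zeta> :: complex
  assumes "l \<ge> 1"
    and "Im \<tau> > 0"
    and generic: "\<And>m::int. m \<noteq> 0 \<Longrightarrow> of_int m * \<eta> \<notin> period_lattice \<tau>"
    and "K \<noteq> 0"
    and log_K: "exp L = K"
    and "\<zeta> \<notin> period_lattice \<tau>"
  shows "(\<forall>j\<le>l. degree (lame_poly \<tau> \<eta> l j) = l - j) \<and>
    lame_poly \<tau> \<eta> l l = 1 \<and>
    ((\<exists>s :: nat \<Rightarrow> complex.
        (\<exists>j\<in>{1..l}. s j \<noteq> 0) \<and>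
        (\<exists>x\<in>lame_domain \<tau> \<eta> l. bloch_ansatz \<tau> \<eta> l L \<zeta> s x \<noteq> 0) \<and>
        double_bloch \<tau> (bloch_ansatz \<tau> \<eta> l L \<zeta> s) \<and>
        (\<forall>x\<in>lame_domain \<tau> \<eta> l. lame_equation \<tau> \<eta> l E (bloch_ansatz \<tau> \<eta> l L \<zeta> s) x))
     \<longleftrightarrow>
     (\<Sum>j=0..l. (-1) ^ j * K powi (- int j) * theta1 \<tau> (\<zeta> - of_nat j * \<eta>)
        * ell_binom \<tau> \<eta> l j * poly (lame_poly \<tau> \<eta> l j) E) = 0 \<and>
     (\<Sum>j=0..l+1. (-1) ^ j * K powi (- int j) * theta1 \<tau> (\<zeta> - of_nat j * \<eta>)
        * ell_num \<tau> \<eta> (int j - 1) * ell_binom \<tau> \<eta> (l + 1) j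
        * poly (lame_poly \<tau> \<eta> l (nat \<bar>int j - 1\<bar>)) E) = 0)"
    (is "_ \<and> _ \<and> (?L \<longleftrightarrow> ?eq1 = 0 \<and> ?eq2 = 0)")
proof -
  interpret generic_elliptic \<tau> \<eta>
    by unfold_locales (use assms in auto)
  let ?t = "lame_coeffs l E K"
  let ?R = "lame_residue l E K \<zeta>"
  have \<zeta>: "theta1 \<tau> \<zeta> \<noteq> 0" using assms(6) by (simp add: theta1_eq_0_iff[OF assms(2)])
  have en_l: "ell_num \<tau> \<eta> (int l) \<noteq> 0" "ell_num \<tau> \<eta> (int l + 1) \<noteq> 0" using assms(1) by simp_all
  have R0: "?R ?t 0 = 0 \<longleftrightarrow> ?eq2 = 0"
  proof -
    have "?R ?t 0 = 0 \<longleftrightarrow> theta1 \<tau> \<zeta> * ?R ?t 0 = 0" using \<zeta> by simp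
    also have "\<dots> \<longleftrightarrow> ?eq2 = 0"
      unfolding lame_residue_0_coeffs[OF assms(4,1) \<zeta>] using en_l by (simp del: ell_num_eq_0_iff)
    finally show ?thesis .
  qed
  have R1: "?R ?t 1 = 0 \<longleftrightarrow> ?eq1 = 0"
  proof -
    have "?R ?t 1 = 0 \<longleftrightarrow> theta1 \<tau> \<zeta> * ?R ?t 1 = 0" using \<zeta> by simp
    also have "\<dots> \<longleftrightarrow> ?eq1 = 0"
      unfolding lame_residue_1_coeffs[OF assms(4,1) \<zeta>] using en_l assms(4) by (simp del: ell_num_eq_0_iff)
    finally show ?thesis .
  qed
  have t_outside: "?t 0 = 0" "?t (Suc l) = 0" by (simp_all add: lame_coeffs_def)
  have t_l: "?t l \<noteq> 0" by (rule lame_coeffs_top_nonzero[OF assms(4,1)])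
  have "?L \<longleftrightarrow> ?eq1 = 0 \<and> ?eq2 = 0"
  proof
    assume ?L
    then obtain s' where s'_nz: "\<exists>j\<in>{1..l}. s' j \<noteq> 0"
      and s'_eq: "\<forall>x\<in>lame_domain \<tau> \<eta> l. lame_equation \<tau> \<eta> l E (bloch_ansatz \<tau> \<eta> l L \<zeta> s') x"
      by blast
    \<comment> \<open>The values of \<open>s'\<close> outside 1..l do not enter the ansatz, but the
      residues refer to the indices 0 and l+1.\<close>
    define s where "s j = (if j \<in> {1..l} then s' j else 0)" for j
    have "bloch_ansatz \<tau> \<eta> l L \<zeta> s' = bloch_ansatz \<tau> \<eta> l L \<zeta> s"
      unfolding bloch_ansatz_def fun_eq_iff s_def by simp
    with s'_eq have "\<forall>m\<le>l. ?R s m = 0"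
      using lame_equation_iff_residues[OF assms(6,1) log_K, of s E] by (simp add: s_def)
    then have res: "?R s m = 0" if "m \<le> l" for m using that by blast
    define c where "c = s l / ?t l"
    have s: "s = (\<lambda>j. c * ?t j)"
    proof
      have s0: "s 0 = 0" "\<And>j. j > l \<Longrightarrow> s j = 0" by (simp_all add: s_def)
      show "s j = c * ?t j" for j
        unfolding c_def by (rule solution_proportional_to_lame_coeffs[where \<zeta> = \<zeta>]) (use assms(1,4) s0 res in auto)
    qed
    obtain j where "j \<in> {1..l}" "s' j \<noteq> 0" using s'_nz by blast
    then have "s j \<noteq> 0" by (simp add: s_def)
    then have "c \<noteq> 0" using fun_cong[OF s, of j] by auto
    have "?R s m = c * ?R ?t m" for m
      using lame_residue_diff_scale[of l E K \<zeta> "\<lambda>_. 0" "- c" ?t m] unfolding s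
      by (simp add: lame_residue_def)
    then have "?R ?t m = 0" if "m \<le> l" for m using res[OF that] \<open>c \<noteq> 0\<close> by simp
    from this[of 0] this[of 1] show "?eq1 = 0 \<and> ?eq2 = 0"
      using R0 R1 assms(1) by blast
  next
    assume eqs: "?eq1 = 0 \<and> ?eq2 = 0"
    have "?R ?t m = 0" if "m \<le> l" for m
    proof -
      consider "m = 0" | "m = 1" | "2 \<le> m" by linarith
      then show ?thesis
        using R0 R1 eqs lame_residue_coeffs[OF assms(4) _ that] by cases auto
    qed
    then have sol: "\<forall>x\<in>lame_domain \<tau> \<eta> l. lame_equation \<tau> \<eta> l E (bloch_ansatz \<tau> \<eta> l L \<zeta> ?t) x"
      using lame_equation_iff_residues[OF assms(6,1) log_K, of ?t E] t_outside by blast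
    \<comment> \<open>Nonzero coefficients give a nonzero function because the translates of
      \<open>Phi\<close> are linearly independent; the coefficient with index l is the nonzero
      one.\<close>
    have "\<exists>x\<in>lame_domain \<tau> \<eta> l. bloch_ansatz \<tau> \<eta> l L \<zeta> ?t x \<noteq> 0"
    proof (rule ccontr)
      assume "\<not> ?thesis"
      then have "(\<Sum>j\<in>{1..l}. ?t j * Phi \<tau> (x - of_nat j * \<eta>) \<zeta>) = 0" if "x \<in> lame_domain \<tau> \<eta> l" for x
        using that by (auto simp: bloch_ansatz_def)
      from Phi_sum_eq_0_imp[OF assms(6) _ _ this, of l] show False using t_l assms(1) by simp
    qed
    moreover have "\<exists>j\<in>{1..l}. ?t j \<noteq> 0" using t_l assms(1) by auto
    ultimately show ?L using sol double_bloch_bloch_ansatz by blast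
  qed
  with degree_lame_poly lame_poly_self show ?thesis by (intro conjI allI impI)
qed

end
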